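(* Let $m\ge 2$, and let $G=F_m$ be the bipartite graph on vertex set $[2m]$ with edge set $\{\{2i,2j-1\} : i=1,\dots,m,\ j=i,\dots,m\}$. Then the Hilbert–Poincaré series of $S/J_G$ is $$\mathrm{HS}_{S/J_G}(t)=\frac{h_0+h_1t+h_2t^2+h_3t^3}{(1-t)^{2m+1}},$$ where $$h_0=1,\qquad h_1=2m-1,\qquad h_2=\frac{3m^2-3m}{2},\qquad h_3=\sum_{k=1}^{m-1}k^2.$$
   Context: Let $K$ be a field. $S=K[x_1,\dots,x_{2m},y_1,\dots,y_{2m}]$ with the standard grading, and the binomial edge ideal $J_G\subset S$ is generated by the binomials $x_iy_j-x_jy_i$ with $\{i,j\}\in E(G)$. The Hilbert–Poincaré series of a graded $S$-module $M$ is $\mathrm{HS}_M(t)=\sum_{d}\dim_K(M_d)\,t^d$. *)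

theory Defs
  imports
    "HOL-Algebra.Embedded_Algebras"
    "HOL-Algebra.QuotRing"
    "HOL-Library.Poly_Mapping"
    "HOL-Computational_Algebra.Formal_Power_Series"
begin

section \<open>Polynomial rings in the variables \<open>x\<^sub>v\<close>, \<open>y\<^sub>v\<close>\<close>

datatype 'v xy_var = XVar 'v | YVar 'v

text \<open>
  A monomial is a finitely supported exponent function, and a polynomial is a finitely
  supported function from monomials to coefficients; the multiplication that
  \<^theory>\<open>HOL-Library.Poly_Mapping\<close> provides on this type is the usual polynomial one
  (convolution).
\<close>

type_synonym 'v monom = "'v xy_var \<Rightarrow>\<^sub>0 nat"
type_synonym ('v, 'k) mpoly = "'v monom \<Rightarrow>\<^sub>0 'k"

definition mvar :: "'v xy_var \<Rightarrow> ('v, 'k::field) mpoly" where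
  "mvar z = Poly_Mapping.single (Poly_Mapping.single z 1) 1"

definition mconst :: "'k::field \<Rightarrow> ('v, 'k) mpoly" where
  "mconst c = Poly_Mapping.single 0 c"

definition monom_deg :: "'v monom \<Rightarrow> nat" where
  "monom_deg u = (\<Sum>z\<in>Poly_Mapping.keys u. Poly_Mapping.lookup u z)"

text \<open>
  The polynomials in the variables \<open>x\<^sub>v\<close>, \<open>y\<^sub>v\<close> with \<open>v \<in> V\<close> only. The type
  \<open>'v\<close> may be larger than \<open>V\<close>, so the variables that occur are restricted.
\<close>

definition xy_poly_carrier :: "'v set \<Rightarrow> ('v, 'k::field) mpoly set" where
  "xy_poly_carrier V =
     {p. \<forall>u\<in>Poly_Mapping.keys p. Poly_Mapping.keys u \<subseteq> XVar ` V \<union> YVar ` V}"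

definition xy_poly_ring :: "'v set \<Rightarrow> ('v, 'k::field) mpoly ring" where
  "xy_poly_ring V =
     \<lparr>carrier = xy_poly_carrier V, monoid.mult = (*), one = 1, zero = 0, add = (+)\<rparr>"

definition homogeneous_part :: "'v set \<Rightarrow> nat \<Rightarrow> ('v, 'k::field) mpoly set" where
  "homogeneous_part V d =
     {p \<in> xy_poly_carrier V. \<forall>u\<in>Poly_Mapping.keys p. monom_deg u = d}"

section \<open>Hilbert--Poincare series\<close>

text \<open>
  \<open>R\<close> is a \<open>K\<close>-algebra, with \<open>K\<close> given as a subset of \<open>R\<close>, and \<open>M d\<close> is the component of
  degree \<open>d\<close>, a \<open>K\<close>-subspace of \<open>R\<close>.
\<close>

definition hilbert_series ::
    "('a, 'b) ring_scheme \<Rightarrow> 'a set \<Rightarrow> (nat \<Rightarrow> 'a set) \<Rightarrow> rat fps" where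
  "hilbert_series R K M = Abs_fps (\<lambda>d. of_nat (ring.dim R K (M d)))"

text \<open>
  For the quotient \<open>S/I\<close> of the polynomial ring by a homogeneous ideal, the field is embedded
  as the classes of the constants, and the degree \<open>d\<close> component is the image of \<open>S\<^sub>d\<close>.
\<close>

definition quotient_scalars ::
    "'v set \<Rightarrow> ('v, 'k::field) mpoly set \<Rightarrow> ('v, 'k) mpoly set set" where
  "quotient_scalars V I = (\<lambda>c. I +>\<^bsub>xy_poly_ring V\<^esub> mconst c) ` UNIV"

definition quotient_part ::
    "'v set \<Rightarrow> ('v, 'k::field) mpoly set \<Rightarrow> nat \<Rightarrow> ('v, 'k) mpoly set set" where
  "quotient_part V I d = (\<lambda>p. I +>\<^bsub>xy_poly_ring V\<^esub> p) ` homogeneous_part V d"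

definition quotient_hilbert_series ::
    "'v set \<Rightarrow> ('v, 'k::field) mpoly set \<Rightarrow> rat fps" where
  "quotient_hilbert_series V I =
     hilbert_series (xy_poly_ring V Quot I) (quotient_scalars V I) (quotient_part V I)"

section \<open>Binomial edge ideals\<close>

text \<open>A graph is a pair of its vertex set and its set of edges (two-element sets of vertices).\<close>

type_synonym 'v graph = "'v set \<times> 'v set set"

definition verts :: "'v graph \<Rightarrow> 'v set" where
  "verts G = fst G"

definition edges :: "'v graph \<Rightarrow> 'v set set" where
  "edges G = snd G"

definition edge_binomial :: "'v \<Rightarrow> 'v \<Rightarrow> ('v, 'k::field) mpoly" where
  "edge_binomial i j = mvar (XVar i) * mvar (YVar j) - mvar (XVar j) * mvar (YVar i)"

text \<open>
  Each edge contributes its binomial for both orders of the endpoints; the two differ by a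
  sign, so the ideal does not depend on an orientation.
\<close>

definition binomial_edge_ideal :: "'v graph \<Rightarrow> ('v, 'k::field) mpoly set" where
  "binomial_edge_ideal G =
     genideal (xy_poly_ring (verts G)) {edge_binomial i j | i j. {i, j} \<in> edges G}"

definition F_graph :: "nat \<Rightarrow> nat graph" where
  "F_graph m = ({1..2 * m}, {{2 * i, 2 * j - 1} | i j. i \<in> {1..m} \<and> j \<in> {i..m}})"

end

theory Submission
  imports Defs
begin

text \<open>
  \<open>J\<^sub>G\<close> is spanned by differences of monomials, so the classes of monomials modulo the exchanges
  \<open>x\<^sub>i y\<^sub>j w \<leftrightarrow> x\<^sub>j y\<^sub>i w\<close> along edges form a basis of \<open>S/J\<^sub>G\<close>. An exchange preserves the
  multidegree \<open>a\<close> (with \<open>x\<^sub>v\<close>, \<open>y\<^sub>v\<close> of degree \<open>e\<^sub>v\<close>) and the total \<open>x\<close>-degree on each connected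
  component \<open>C\<close> of the subgraph induced on the support of \<open>a\<close>, and two monomials that agree in
  these data are equivalent. Hence there are \<open>\<Prod>\<^sub>C (a(C) + 1)\<close> classes of multidegree \<open>a\<close>, over any
  field. For \<open>F\<^sub>m\<close> the support of \<open>a\<close> induces at most one component with edges: it consists of the
  vertices of the support in an interval \<open>[2\<alpha> - 1, 2\<beta>]\<close>, and all other vertices are isolated. The
  series is the sum of the contributions of the possible \<open>(\<alpha>, \<beta>)\<close>, each of which is explicit.
\<close>

section \<open>Restricted polynomial rings\<close>

definition monoms :: "'v set \<Rightarrow> 'v monom set" where
  "monoms V = {u. Poly_Mapping.keys u \<subseteq> XVar ` V \<union> YVar ` V}"

lemma xy_poly_carrier_eq: "xy_poly_carrier V = {p. Poly_Mapping.keys p \<subseteq> monoms V}"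
  by (auto simp: xy_poly_carrier_def monoms_def)

lemma zero_in_monoms [simp]: "0 \<in> monoms V"
  by (simp add: monoms_def)

lemma monoms_add: "u \<in> monoms V \<Longrightarrow> w \<in> monoms V \<Longrightarrow> u + w \<in> monoms V"
  using Poly_Mapping.keys_add[of u w] unfolding monoms_def by blast

lemma single_in_monoms:
  "z \<in> XVar ` V \<union> YVar ` V \<Longrightarrow> Poly_Mapping.single z n \<in> monoms V"
  by (simp add: monoms_def)

lemma xy_poly_carrier_add:
  "p \<in> xy_poly_carrier V \<Longrightarrow> q \<in> xy_poly_carrier V \<Longrightarrow> p + q \<in> xy_poly_carrier V"
  using Poly_Mapping.keys_add[of p q] unfolding xy_poly_carrier_eq by blast

lemma xy_poly_carrier_uminus:
  "p \<in> xy_poly_carrier V \<Longrightarrow> - p \<in> xy_poly_carrier V"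
  by (simp add: xy_poly_carrier_eq subset_iff in_keys_iff)

lemma xy_poly_carrier_diff:
  "p \<in> xy_poly_carrier V \<Longrightarrow> q \<in> xy_poly_carrier V \<Longrightarrow> p - q \<in> xy_poly_carrier V"
  using xy_poly_carrier_add[of p V "- q"] xy_poly_carrier_uminus[of q V] by simp

lemma xy_poly_carrier_mult:
  "p \<in> xy_poly_carrier V \<Longrightarrow> q \<in> xy_poly_carrier V \<Longrightarrow> p * q \<in> xy_poly_carrier V"
  using Poly_Mapping.keys_mult[of p q] monoms_add[of _ V] unfolding xy_poly_carrier_eq by blast

lemma xy_poly_carrier_single:
  "u \<in> monoms V \<Longrightarrow> Poly_Mapping.single u c \<in> xy_poly_carrier V"
  by (simp add: xy_poly_carrier_eq)

lemma xy_poly_ring_simps [simp]: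
  "carrier (xy_poly_ring V) = xy_poly_carrier V"
  "x \<otimes>\<^bsub>xy_poly_ring V\<^esub> y = x * y"
  "\<one>\<^bsub>xy_poly_ring V\<^esub> = 1"
  "\<zero>\<^bsub>xy_poly_ring V\<^esub> = 0"
  "x \<oplus>\<^bsub>xy_poly_ring V\<^esub> y = x + y"
  by (simp_all add: xy_poly_ring_def)

lemma xy_poly_carrier_0 [simp]: "0 \<in> xy_poly_carrier V"
  and xy_poly_carrier_1 [simp]: "1 \<in> xy_poly_carrier V"
  by (simp_all add: xy_poly_carrier_eq)

lemma cring_xy_poly_ring: "cring (xy_poly_ring V :: ('v, 'k::field) mpoly ring)"
proof (rule cringI)
  show "abelian_group (xy_poly_ring V :: ('v, 'k) mpoly ring)"
    by (rule abelian_groupI)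
       (auto simp: xy_poly_carrier_add add_ac intro!: bexI[of _ "- x" for x] xy_poly_carrier_uminus)
  show "comm_monoid (xy_poly_ring V :: ('v, 'k) mpoly ring)"
    by unfold_locales (auto simp: xy_poly_carrier_mult mult_ac)
qed (auto simp: algebra_simps)

lemma a_minus_xy_poly_ring:
  fixes p q :: "('v, 'k::field) mpoly"
  assumes "p \<in> xy_poly_carrier V" "q \<in> xy_poly_carrier V"
  shows "p \<ominus>\<^bsub>xy_poly_ring V\<^esub> q = p - q"
proof -
  interpret cring "xy_poly_ring V :: ('v, 'k) mpoly ring" by (rule cring_xy_poly_ring)
  have "\<ominus>\<^bsub>xy_poly_ring V\<^esub> q = - q"
    by (rule minus_equality) (use assms in \<open>auto simp: xy_poly_carrier_uminus\<close>)
  then show ?thesis by (simp add: a_minus_def)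
qed

lemma poly_mapping_sum_single:
  "p = (\<Sum>u\<in>Poly_Mapping.keys p. Poly_Mapping.single u (Poly_Mapping.lookup p u))"
  by (rule poly_mapping_eqI)
     (auto simp: lookup_sum lookup_single when_def in_keys_iff)

text \<open>Dimension is taken over a subfield of the ring, so the constants must first be one; the
  scalars of the quotient inherit this along the projection.\<close>

lemma subfield_range_mconst:
  "subfield (range mconst) (xy_poly_ring V :: ('v, 'k::field) mpoly ring)"
proof -
  let ?R = "xy_poly_ring V :: ('v, 'k) mpoly ring"
  interpret cring ?R by (rule cring_xy_poly_ring)
  have carr: "range mconst \<subseteq> xy_poly_carrier V"
    by (auto simp: mconst_def xy_poly_carrier_single)
  have add: "mconst a + mconst b = mconst (a + b)" for a b :: 'k
    by (simp add: mconst_def single_add)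
  have mult: "mconst a * mconst b = mconst (a * b)" for a b :: 'k
    by (simp add: mconst_def mult_single)
  have one: "1 = mconst (1 :: 'k)" and zero: "0 = mconst (0 :: 'k)"
    by (simp_all add: mconst_def)
  have inj: "mconst a = mconst b \<longleftrightarrow> a = b" for a b :: 'k
    by (metis mconst_def lookup_single_eq)
  have "cring (?R\<lparr>carrier := range mconst\<rparr>)"
  proof (rule cringI)
    show "abelian_group (?R\<lparr>carrier := range mconst\<rparr>)"
    proof (rule abelian_groupI)
      fix x assume "x \<in> carrier (?R\<lparr>carrier := range mconst\<rparr>)"
      then obtain a where "x = mconst a" by auto
      then show "\<exists>y\<in>carrier (?R\<lparr>carrier := range mconst\<rparr>).
          y \<oplus>\<^bsub>?R\<lparr>carrier := range mconst\<rparr>\<^esub> x = \<zero>\<^bsub>?R\<lparr>carrier := range mconst\<rparr>\<^esub>"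
        by (intro bexI[of _ "mconst (- a)"]) (auto simp: add zero)
    qed (use add in \<open>auto simp: add_ac zero\<close>)
    show "comm_monoid (?R\<lparr>carrier := range mconst\<rparr>)"
      by unfold_locales (auto simp: mult one mult_ac)
  qed (auto simp: algebra_simps)
  moreover have "Units (?R\<lparr>carrier := range mconst\<rparr>) = range mconst - {0}"
  proof -
    have "\<exists>b::'k. b * a = 1 \<and> a * b = 1" if "a \<noteq> 0" for a :: 'k
      using that by (intro exI[of _ "inverse a"]) simp
    then show ?thesis
      by (auto simp: Units_def mult one zero inj)
  qed
  ultimately have "field (?R\<lparr>carrier := range mconst\<rparr>)"
    by (intro cring.cring_fieldI) auto
  then show ?thesis
    using carr by (intro subfield_iff(1)) auto
qed

section \<open>Quotients that identify monomials\<close>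

text \<open>The coefficient of the class \<open>\<gamma>\<close> in the image of \<open>p\<close> in the vector space on the classes.\<close>

definition class_coeff :: "('v monom \<Rightarrow> 'c) \<Rightarrow> 'c \<Rightarrow> ('v, 'k::field) mpoly \<Rightarrow> 'k" where
  "class_coeff c \<gamma> p =
     (\<Sum>u\<in>Poly_Mapping.keys p. if c u = \<gamma> then Poly_Mapping.lookup p u else 0)"

lemma class_coeff_add: "class_coeff c \<gamma> (p + q) = class_coeff c \<gamma> p + class_coeff c \<gamma> q"
  unfolding class_coeff_def
  by (rule setsum_keys_plus_distrib[where f = "\<lambda>u a. if c u = \<gamma> then a else 0"]) auto

lemma class_coeff_0 [simp]: "class_coeff c \<gamma> 0 = 0"
  by (simp add: class_coeff_def)

lemma class_coeff_uminus: "class_coeff c \<gamma> (- p) = - class_coeff c \<gamma> p"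
  using class_coeff_add[of c \<gamma> p "- p"] by (simp add: eq_neg_iff_add_eq_0 add.commute)

lemma class_coeff_diff: "class_coeff c \<gamma> (p - q) = class_coeff c \<gamma> p - class_coeff c \<gamma> q"
  using class_coeff_add[of c \<gamma> p "- q"] by (simp add: class_coeff_uminus)

lemma class_coeff_sum: "class_coeff c \<gamma> (sum f A) = (\<Sum>i\<in>A. class_coeff c \<gamma> (f i))"
  by (induction A rule: infinite_finite_induct) (auto simp: class_coeff_add)

lemma class_coeff_single:
  "class_coeff c \<gamma> (Poly_Mapping.single u a) = (if c u = \<gamma> then a else 0)"
  by (simp add: class_coeff_def)

text \<open>The polynomials all of whose multiples have zero class coefficients form an ideal. By
  linearity, a generator needs testing on monomial multiples only.\<close>

lemma class_coeff_genideal: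
  fixes B :: "('v, 'k::field) mpoly set"
  assumes B: "B \<subseteq> xy_poly_carrier V"
    and gen: "\<And>w b \<gamma>. w \<in> monoms V \<Longrightarrow> b \<in> B \<Longrightarrow>
      class_coeff c \<gamma> (Poly_Mapping.single w 1 * b) = 0"
    and p: "p \<in> genideal (xy_poly_ring V) B"
  shows "class_coeff c \<gamma> p = 0"
proof -
  let ?R = "xy_poly_ring V :: ('v, 'k) mpoly ring"
  interpret cring ?R by (rule cring_xy_poly_ring)
  \<comment> \<open>The kernel of \<open>class_coeff\<close> alone need not absorb products, so all
    multiples of \<open>p\<close> are built into the condition; the multiplier 1 recovers
    \<open>p\<close> itself.\<close>
  define N where "N = {p \<in> xy_poly_carrier V.
    \<forall>q \<in> xy_poly_carrier V. \<forall>\<gamma>. class_coeff c \<gamma> (q * p :: ('v, 'k) mpoly) = 0}"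
  have scale: "class_coeff c \<gamma> (Poly_Mapping.single 0 a * p) = a * class_coeff c \<gamma> p"
    for a \<gamma> and p :: "('v, 'k) mpoly"
  proof -
    have "Poly_Mapping.single 0 a * p =
        (\<Sum>u\<in>Poly_Mapping.keys p. Poly_Mapping.single u (a * Poly_Mapping.lookup p u))"
      by (subst poly_mapping_sum_single[of p]) (simp add: sum_distrib_left mult_single)
    then show ?thesis
      by (auto simp: class_coeff_sum class_coeff_single sum_distrib_left class_coeff_def[of _ _ p] intro!: sum.cong)
  qed
  have "ideal N ?R"
  proof (rule idealI)
    show "subgroup N (add_monoid ?R)"
    proof (rule add.subgroupI)
      show "\<ominus>\<^bsub>?R\<^esub> a \<in> N" if "a \<in> N" for a
      proof -
        have "\<ominus>\<^bsub>?R\<^esub> a = - a"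
          by (rule minus_equality) (use that in \<open>auto simp: N_def xy_poly_carrier_uminus\<close>)
        then show ?thesis
          using that by (auto simp: N_def xy_poly_carrier_uminus class_coeff_uminus)
      qed
      have "0 \<in> N" by (simp add: N_def)
      then show "N \<noteq> {}" by auto
    qed (auto simp: N_def distrib_left class_coeff_add xy_poly_carrier_add)
    show "x \<otimes>\<^bsub>?R\<^esub> a \<in> N" if "a \<in> N" "x \<in> carrier ?R" for a x
      using that by (auto simp: N_def xy_poly_carrier_mult mult.assoc[symmetric])
    show "a \<otimes>\<^bsub>?R\<^esub> x \<in> N" if "a \<in> N" "x \<in> carrier ?R" for a x
      using that by (auto simp: N_def xy_poly_carrier_mult mult.commute[of a] mult.assoc[symmetric])
  qed (rule ring_axioms)
  moreover have "B \<subseteq> N"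
  proof
    fix b assume b: "b \<in> B"
    have "class_coeff c \<gamma> (q * b) = 0" if q: "q \<in> xy_poly_carrier V" for q \<gamma>
    proof -
      have "q * b = (\<Sum>u\<in>Poly_Mapping.keys q.
          Poly_Mapping.single 0 (Poly_Mapping.lookup q u) * (Poly_Mapping.single u 1 * b))"
        by (subst poly_mapping_sum_single[of q])
           (simp add: sum_distrib_right mult.assoc[symmetric] mult_single)
      then show ?thesis
        using q b by (auto simp: class_coeff_sum scale xy_poly_carrier_eq subset_iff intro!: sum.neutral gen)
    qed
    then show "b \<in> N" using b B by (auto simp: N_def)
  qed
  ultimately have "p \<in> N" using genideal_minimal p by blast
  then have "class_coeff c \<gamma> (1 * p) = 0"
    unfolding N_def using xy_poly_carrier_1[of V] by blast
  then show ?thesis by simp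
qed

text \<open>A complete set of representatives of the classes of monomials maps to a basis.\<close>

lemma dim_quotient_part:
  fixes I :: "('v, 'k::field) mpoly set"
  assumes I: "ideal I (xy_poly_ring V)"
    and sep: "\<And>p \<gamma>. p \<in> I \<Longrightarrow> class_coeff c \<gamma> p = 0"
    and identify: "\<And>u u'. u \<in> monoms V \<Longrightarrow> u' \<in> monoms V \<Longrightarrow> c u = c u' \<Longrightarrow>
      Poly_Mapping.single u 1 - Poly_Mapping.single u' 1 \<in> I"
    and fin: "finite (c ` {u \<in> monoms V. monom_deg u = d})"
  shows "ring.dim (xy_poly_ring V Quot I) (quotient_scalars V I) (quotient_part V I d) =
    card (c ` {u \<in> monoms V. monom_deg u = d})"
proof -
  let ?R = "xy_poly_ring V :: ('v, 'k) mpoly ring"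
  let ?Q = "?R Quot I"
  let ?K = "quotient_scalars V I"
  let ?s = "\<lambda>u. Poly_Mapping.single u (1::'k)"
  interpret R: cring ?R by (rule cring_xy_poly_ring)
  interpret I: ideal I ?R by (rule I)
  interpret Q: ring ?Q by (rule I.quotient_is_ring)
  let ?h = "\<lambda>p. I +>\<^bsub>?R\<^esub> p"
  interpret h: ring_hom_ring ?R ?Q ?h by (rule I.rcos_ring_hom_ring)
  have eq_iff: "?h p = ?h q \<longleftrightarrow> p - q \<in> I"
    if "p \<in> xy_poly_carrier V" "q \<in> xy_poly_carrier V" for p q
    using R.quotient_eq_iff_same_a_r_cos[OF I, of p q] that
    by (simp add: a_minus_xy_poly_ring)
  have mc: "mconst k \<in> xy_poly_carrier V" for k :: 'k
    by (simp add: mconst_def xy_poly_carrier_single)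
  have lin: "?h (a * b + q) = ?h a \<otimes>\<^bsub>?Q\<^esub> ?h b \<oplus>\<^bsub>?Q\<^esub> ?h q"
    if "a \<in> xy_poly_carrier V" "b \<in> xy_poly_carrier V" "q \<in> xy_poly_carrier V" for a b q
    using that h.hom_mult[of a b] h.hom_add[of "a * b" q] by (simp add: xy_poly_carrier_mult)
  \<comment> \<open>The constant 1 has coefficient 1 at its own class. Hence the quotient is
    nontrivial and the constants remain a field in it.\<close>
  have "1 \<notin> I"
  proof
    assume "1 \<in> I"
    then have "class_coeff c (c 0) (1 :: ('v,'k) mpoly) = 0" by (rule sep)
    then show False by (simp add: class_coeff_def)
  qed
  then have "?h 1 \<noteq> ?h 0" by (subst eq_iff) auto
  then have "\<one>\<^bsub>?Q\<^esub> \<noteq> \<zero>\<^bsub>?Q\<^esub>"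
    using h.hom_one h.hom_zero by simp
  then have K: "subfield ?K ?Q"
    unfolding quotient_scalars_def
    using h.img_is_subfield(2)[OF subfield_range_mconst] by (simp add: image_image)
  \<comment> \<open>Induction on a set of monomials from pairwise different classes: each further
    monomial enlarges the span by one line.\<close>
  have dimension: "Q.dimension (card T) ?K (?h ` {p. Poly_Mapping.keys p \<subseteq> T})"
    if "finite T" "T \<subseteq> monoms V" "inj_on c T" for T
    using that
  proof (induction T rule: finite_induct)
    case empty
    have "?h ` {p. Poly_Mapping.keys p \<subseteq> {}} = {\<zero>\<^bsub>?Q\<^esub>}"
      using h.hom_zero by simp
    then show ?case using Q.zero_dim by simp
  next
    case (insert r T)
    have r: "?s r \<in> xy_poly_carrier V"
      using insert.prems by (simp add: xy_poly_carrier_single)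
    have T: "p \<in> xy_poly_carrier V" if "Poly_Mapping.keys p \<subseteq> T" for p :: "('v, 'k) mpoly"
      using that insert.prems by (auto simp: xy_poly_carrier_eq)
    have notin: "?h (?s r) \<notin> ?h ` {p. Poly_Mapping.keys p \<subseteq> T}"
    proof
      assume "?h (?s r) \<in> ?h ` {p. Poly_Mapping.keys p \<subseteq> T}"
      then obtain p :: "('v, 'k) mpoly"
        where p: "Poly_Mapping.keys p \<subseteq> T" "?h (?s r) = ?h p" by auto
      then have "?s r - p \<in> I" using eq_iff r T by auto
      \<comment> \<open>At the class of \<open>r\<close>, the monomial \<open>r\<close> contributes
        1, while \<open>p\<close> lives on other classes because \<open>c\<close> is injective on
        \<open>insert r T\<close>.\<close>
      then have "class_coeff c (c r) (?s r - p) = 0" by (rule sep)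
      moreover have "class_coeff c (c r) p = 0"
        unfolding class_coeff_def using p insert by (intro sum.neutral) (auto simp: inj_on_def)
      ultimately show False by (simp add: class_coeff_diff class_coeff_single)
    qed
    have "Q.line_extension ?K (?h (?s r)) (?h ` {p. Poly_Mapping.keys p \<subseteq> T}) =
        ?h ` {p. Poly_Mapping.keys p \<subseteq> insert r T}"
    proof (intro equalityI subsetI)
      fix x assume "x \<in> Q.line_extension ?K (?h (?s r)) (?h ` {p. Poly_Mapping.keys p \<subseteq> T})"
      then obtain k :: 'k and p :: "('v, 'k) mpoly" where p: "Poly_Mapping.keys p \<subseteq> T"
        and x: "x = ?h (mconst k) \<otimes>\<^bsub>?Q\<^esub> ?h (?s r) \<oplus>\<^bsub>?Q\<^esub> ?h p"
        by (auto simp: Q.line_extension_mem_iff quotient_scalars_def)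
      have "x = ?h (mconst k * ?s r + p)"
        unfolding x using T[OF p] by (simp add: lin r mc)
      moreover have "mconst k * ?s r = Poly_Mapping.single r k"
        by (simp add: mconst_def mult_single)
      moreover have "Poly_Mapping.keys (Poly_Mapping.single r k + p) \<subseteq> insert r T"
        using Poly_Mapping.keys_add[of "Poly_Mapping.single r k" p] p by (auto split: if_splits)
      ultimately show "x \<in> ?h ` {p. Poly_Mapping.keys p \<subseteq> insert r T}" by auto
    next
      fix x assume "x \<in> ?h ` {p. Poly_Mapping.keys p \<subseteq> insert r T}"
      then obtain p :: "('v, 'k) mpoly"
        where p: "Poly_Mapping.keys p \<subseteq> insert r T" and x: "x = ?h p" by auto
      define k where "k = Poly_Mapping.lookup p r"
      define q where "q = p - Poly_Mapping.single r k"
      have q: "Poly_Mapping.keys q \<subseteq> T"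
        using p by (auto simp: q_def k_def in_keys_iff lookup_minus lookup_single when_def split: if_splits)
      have "p = mconst k * ?s r + q"
        by (simp add: mconst_def mult_single q_def)
      then have "x = ?h (mconst k) \<otimes>\<^bsub>?Q\<^esub> ?h (?s r) \<oplus>\<^bsub>?Q\<^esub> ?h q"
        unfolding x using T[OF q] by (simp add: lin r mc)
      then show "x \<in> Q.line_extension ?K (?h (?s r)) (?h ` {p. Poly_Mapping.keys p \<subseteq> T})"
        using q by (auto simp: Q.line_extension_mem_iff quotient_scalars_def)
    qed
    moreover have "?h (?s r) \<in> carrier ?Q" using r by simp
    ultimately show ?case
      using Q.Suc_dim[OF _ notin] insert by fastforce
  qed
  let ?M = "{u \<in> monoms V. monom_deg u = d}"
  \<comment> \<open>A transversal: one monomial of degree \<open>d\<close> for each class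
    attained.\<close>
  obtain T where T: "T \<subseteq> ?M" "inj_on c T" "c ` ?M = c ` T"
    using subset_image_inj[of "c ` ?M" c ?M] by auto
  have finT: "finite T" using fin T by (simp add: finite_image_iff)
  define rep where "rep u = (SOME r. r \<in> T \<and> c r = c u)" for u
  have rep: "rep u \<in> T \<and> c (rep u) = c u" if "u \<in> ?M" for u
    unfolding rep_def by (rule someI_ex) (use that T in \<open>force simp: image_iff\<close>)
  have "?h ` {p. Poly_Mapping.keys p \<subseteq> T} = quotient_part V I d"
  proof (intro equalityI subsetI)
    fix x assume "x \<in> ?h ` {p. Poly_Mapping.keys p \<subseteq> T}"
    then show "x \<in> quotient_part V I d"
      using T by (auto simp: quotient_part_def homogeneous_part_def xy_poly_carrier_eq intro!: imageI)
  next
    fix x assume "x \<in> quotient_part V I d"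
    then obtain p :: "('v, 'k) mpoly" where x: "x = ?h p" and p: "Poly_Mapping.keys p \<subseteq> ?M"
      by (auto simp: quotient_part_def homogeneous_part_def xy_poly_carrier_eq)
    \<comment> \<open>Each monomial of \<open>p\<close> is replaced by its representative;
      \<open>p - q\<close> is then a combination of the differences that \<open>identify\<close>
      puts into \<open>I\<close>.\<close>
    define q where
      "q = (\<Sum>u\<in>Poly_Mapping.keys p. Poly_Mapping.single (rep u) (Poly_Mapping.lookup p u))"
    have q: "Poly_Mapping.keys q \<subseteq> T"
    proof -
      have "Poly_Mapping.keys q \<subseteq> (\<Union>u\<in>Poly_Mapping.keys p.
          Poly_Mapping.keys (Poly_Mapping.single (rep u) (Poly_Mapping.lookup p u)))"
        unfolding q_def by (rule Poly_Mapping.keys_sum)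
      then show ?thesis using rep p by (force split: if_splits)
    qed
    have "(\<Sum>u\<in>A. mconst (Poly_Mapping.lookup p u) * (?s u - ?s (rep u))) \<in> I"
      if "finite A" "A \<subseteq> Poly_Mapping.keys p" for A
      using that
    proof (induction A rule: finite_induct)
      case empty
      then show ?case using I.zero_closed by simp
    next
      case (insert u A)
      then have "?s u - ?s (rep u) \<in> I" using p rep[of u] T by (intro identify) auto
      then have "mconst (Poly_Mapping.lookup p u) * (?s u - ?s (rep u)) \<in> I"
        using I.I_l_closed[of _ "mconst (Poly_Mapping.lookup p u)"] mc by simp
      then show ?case using insert I.a_closed by simp
    qed
    from this[of "Poly_Mapping.keys p"]
    have "(\<Sum>u\<in>Poly_Mapping.keys p. mconst (Poly_Mapping.lookup p u) * (?s u - ?s (rep u))) \<in> I"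
      by simp
    also have "(\<Sum>u\<in>Poly_Mapping.keys p. mconst (Poly_Mapping.lookup p u) * (?s u - ?s (rep u))) = p - q"
      using poly_mapping_sum_single[of p]
      by (simp add: q_def mconst_def right_diff_distrib mult_single sum_subtractf)
    finally have "?h p = ?h q"
      using p q T by (subst eq_iff) (auto simp: xy_poly_carrier_eq)
    then show "x \<in> ?h ` {p. Poly_Mapping.keys p \<subseteq> T}" using q x by auto
  qed
  then have "Q.dimension (card T) ?K (quotient_part V I d)"
    using dimension[OF finT] T by auto
  then have "(Q.dim over ?K) (quotient_part V I d) = card T"
    by (rule Q.dimI[OF K])
  then show ?thesis
    using T by (simp add: over_def card_image)
qed

section \<open>Classes of monomials modulo a binomial edge ideal\<close>

definition edge_rel :: "'v set set \<Rightarrow> 'v set \<Rightarrow> ('v \<times> 'v) set" where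
  "edge_rel E W = {(i, j). i \<in> W \<and> j \<in> W \<and> {i, j} \<in> E}"

definition component :: "'v set set \<Rightarrow> 'v set \<Rightarrow> 'v \<Rightarrow> 'v set" where
  "component E W v = (edge_rel E W)\<^sup>* `` {v}"

definition support :: "('v \<Rightarrow> nat) \<Rightarrow> 'v set" where
  "support a = {v. a v \<noteq> 0}"

abbreviation components :: "'v set set \<Rightarrow> 'v set \<Rightarrow> 'v set set" where
  "components E W \<equiv> component E W ` W"

lemma sym_edge_rel_rtrancl: "sym ((edge_rel E W)\<^sup>*)"
  by (rule sym_rtrancl) (auto simp: sym_def edge_rel_def insert_commute)

lemma component_self: "v \<in> component E W v"
  by (simp add: component_def)

lemma component_eq:
  assumes "w \<in> component E W v"
  shows "component E W w = component E W v"
proof -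
  have vw: "(v, w) \<in> (edge_rel E W)\<^sup>*" using assms by (simp add: component_def)
  then have wv: "(w, v) \<in> (edge_rel E W)\<^sup>*" by (rule symD[OF sym_edge_rel_rtrancl])
  show ?thesis
    unfolding component_def using rtrancl_trans[OF vw] rtrancl_trans[OF wv] by auto
qed

lemma component_subset: "v \<in> W \<Longrightarrow> component E W v \<subseteq> W"
proof
  fix w assume "w \<in> component E W v" and v: "v \<in> W"
  then have "(v, w) \<in> (edge_rel E W)\<^sup>*" by (simp add: component_def)
  then show "w \<in> W"
    by (induction rule: rtrancl_induct) (use v in \<open>auto simp: edge_rel_def\<close>)
qed

lemma finite_component: "finite W \<Longrightarrow> v \<in> W \<Longrightarrow> finite (component E W v)"
  by (rule finite_subset[OF component_subset])

section \<open>Exchange invariants of monomials\<close>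

definition multidegree :: "'v monom \<Rightarrow> 'v \<Rightarrow> nat" where
  "multidegree u v = Poly_Mapping.lookup u (XVar v) + Poly_Mapping.lookup u (YVar v)"

text \<open>The x-degrees are kept as an extensional function, so that only actual components matter
  for equality and the classes of one multidegree form a \<open>PiE\<close>.\<close>

definition monom_class :: "'v set set \<Rightarrow> 'v monom \<Rightarrow> ('v \<Rightarrow> nat) \<times> ('v set \<Rightarrow> nat)" where
  "monom_class E u = (multidegree u,
     \<lambda>C\<in>components E (support (multidegree u)). \<Sum>v\<in>C. Poly_Mapping.lookup u (XVar v))"

definition xm :: "'v \<Rightarrow> 'v monom" where "xm v = Poly_Mapping.single (XVar v) 1"
definition ym :: "'v \<Rightarrow> 'v monom" where "ym v = Poly_Mapping.single (YVar v) 1"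

lemma lookup_xm_ym [simp]:
  "Poly_Mapping.lookup (xm i) (XVar v) = of_bool (v = i)"
  "Poly_Mapping.lookup (ym i) (YVar v) = of_bool (v = i)"
  "Poly_Mapping.lookup (xm i) (YVar v) = 0"
  "Poly_Mapping.lookup (ym i) (XVar v) = 0"
  by (auto simp: xm_def ym_def lookup_single when_def)

lemma monom_eqI:
  assumes "\<And>v. Poly_Mapping.lookup u (XVar v) = Poly_Mapping.lookup u' (XVar v)"
    and "\<And>v. Poly_Mapping.lookup u (YVar v) = Poly_Mapping.lookup u' (YVar v)"
  shows "u = u'"
proof (rule poly_mapping_eqI)
  show "Poly_Mapping.lookup u z = Poly_Mapping.lookup u' z" for z
    by (cases z) (simp_all add: assms)
qed

lemma xm_in_monoms: "v \<in> V \<Longrightarrow> xm v \<in> monoms V"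
  and ym_in_monoms: "v \<in> V \<Longrightarrow> ym v \<in> monoms V"
  by (auto simp: xm_def ym_def intro!: single_in_monoms)

lemma monoms_diff: "u \<in> monoms V \<Longrightarrow> u - w \<in> monoms V"
  unfolding monoms_def by (auto simp: in_keys_iff lookup_minus subset_iff)

lemma finite_support_multidegree: "finite (support (multidegree u))"
proof -
  have "support (multidegree u) \<subseteq> XVar -` Poly_Mapping.keys u \<union> YVar -` Poly_Mapping.keys u"
    by (auto simp: support_def multidegree_def in_keys_iff)
  then show ?thesis
    by (rule finite_subset) (auto intro!: finite_vimageI simp: inj_def)
qed

lemma support_multidegree_subset: "u \<in> monoms V \<Longrightarrow> support (multidegree u) \<subseteq> V"
proof
  fix v assume u: "u \<in> monoms V" and "v \<in> support (multidegree u)"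
  then have "XVar v \<in> Poly_Mapping.keys u \<or> YVar v \<in> Poly_Mapping.keys u"
    by (auto simp: support_def multidegree_def in_keys_iff)
  then show "v \<in> V" using u unfolding monoms_def by blast
qed

lemma multidegree_swap: "multidegree (w + xm j + ym i) = multidegree (w + xm i + ym j)"
  by (auto simp: multidegree_def lookup_add fun_eq_iff)

text \<open>The ends of a path lie in the same component, so moving an x from one to the other
  changes no component total.\<close>

lemma monom_class_swap:
  assumes path: "(i, j) \<in> (edge_rel E (support (multidegree (w + xm i + ym j))))\<^sup>*"
  shows "monom_class E (w + xm j + ym i) = monom_class E (w + xm i + ym j)"
proof -
  let ?S = "support (multidegree (w + xm i + ym j))"
  have "(\<Sum>v\<in>C. Poly_Mapping.lookup (w + xm j + ym i) (XVar v)) =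
      (\<Sum>v\<in>C. Poly_Mapping.lookup (w + xm i + ym j) (XVar v))"
    if C: "C \<in> components E ?S" for C
  proof -
    have "finite C" using C by (auto intro: finite_component finite_support_multidegree)
    moreover have "i \<in> C \<longleftrightarrow> j \<in> C"
      using C rtrancl_trans[OF _ path] rtrancl_trans[OF _ symD[OF sym_edge_rel_rtrancl path]]
      by (auto simp: component_def)
    ultimately show ?thesis
      by (simp add: lookup_add sum.distrib of_bool_def)
  qed
  then show ?thesis
    unfolding monom_class_def multidegree_swap by (simp cong: restrict_cong)
qed

text \<open>The bridge from ideal membership to exchanges along edges; \<open>w\<close> is the part
  of the monomial that an exchange leaves alone.\<close>

lemma single_times_edge_binomial:
  "Poly_Mapping.single w 1 * edge_binomial i j =
     Poly_Mapping.single (w + xm i + ym j) 1 - Poly_Mapping.single (w + xm j + ym i) 1"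
  by (simp add: edge_binomial_def mvar_def xm_def ym_def right_diff_distrib mult_single add.assoc)

section \<open>Equivalence of monomials modulo the edge ideal\<close>

locale edge_ideal =
  fixes V :: "'v set" and E :: "'v set set" and J :: "('v, 'k::field) mpoly set"
  assumes finite_V: "finite V"
    and E_subset: "\<Union> E \<subseteq> V"
    and J_eq: "J = genideal (xy_poly_ring V) {edge_binomial i j | i j. {i, j} \<in> E}"
begin

lemma edge_binomials_subset:
  "{edge_binomial i j | i j. {i, j} \<in> E} \<subseteq> (xy_poly_carrier V :: ('v, 'k) mpoly set)"
proof -
  have "(edge_binomial i j :: ('v, 'k) mpoly) \<in> xy_poly_carrier V" if "{i, j} \<in> E" for i j
    using that E_subset unfolding edge_binomial_def mvar_def
    by (intro xy_poly_carrier_diff xy_poly_carrier_mult xy_poly_carrier_single single_in_monoms) auto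
  then show ?thesis by auto
qed

lemma ideal_J: "ideal J (xy_poly_ring V)"
proof -
  interpret cring "xy_poly_ring V :: ('v, 'k) mpoly ring" by (rule cring_xy_poly_ring)
  show ?thesis unfolding J_eq by (rule genideal_ideal) (simp add: edge_binomials_subset)
qed

text \<open>Both monomials in a multiple of a generator have the two ends of the edge in their
  support, hence share a class, and their coefficients 1 and -1 cancel.\<close>

lemma class_coeff_J:
  assumes "p \<in> J"
  shows "class_coeff (monom_class E) \<gamma> p = 0"
proof (rule class_coeff_genideal)
  fix w and b :: "('v, 'k) mpoly" and \<gamma>
  assume "b \<in> {edge_binomial i j | i j. {i, j} \<in> E}"
  then obtain i j where b: "b = edge_binomial i j" and ij: "{i, j} \<in> E" by auto
  have "(i, j) \<in> edge_rel E (support (multidegree (w + xm i + ym j)))"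
    using ij by (auto simp: edge_rel_def support_def multidegree_def lookup_add)
  then have "monom_class E (w + xm j + ym i) = monom_class E (w + xm i + ym j)"
    by (intro monom_class_swap) auto
  then show "class_coeff (monom_class E) \<gamma> (Poly_Mapping.single w 1 * b) = 0"
    unfolding b single_times_edge_binomial class_coeff_diff class_coeff_single by simp
qed (use assms edge_binomials_subset in \<open>auto simp: J_eq\<close>)

definition equiv_J :: "'v monom \<Rightarrow> 'v monom \<Rightarrow> bool" (infix "\<approx>" 50) where
  "u \<approx> u' \<longleftrightarrow> Poly_Mapping.single u 1 - Poly_Mapping.single u' 1 \<in> J"

lemma J_closed:
  shows "0 \<in> J" "p \<in> J \<Longrightarrow> q \<in> J \<Longrightarrow> p + q \<in> J"
    and "q \<in> xy_poly_carrier V \<Longrightarrow> p \<in> J \<Longrightarrow> q * p \<in> J"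
proof -
  interpret R: cring "xy_poly_ring V :: ('v, 'k) mpoly ring" by (rule cring_xy_poly_ring)
  interpret I: ideal J "xy_poly_ring V" by (rule ideal_J)
  show "0 \<in> J" "p \<in> J \<Longrightarrow> q \<in> J \<Longrightarrow> p + q \<in> J"
    "q \<in> xy_poly_carrier V \<Longrightarrow> p \<in> J \<Longrightarrow> q * p \<in> J"
    using I.zero_closed I.a_closed[of p q] I.I_l_closed[of p q] by simp_all
qed

lemma equiv_J_refl: "u \<approx> u"
  by (simp add: equiv_J_def J_closed)

lemma equiv_J_trans [trans]: "u \<approx> u' \<Longrightarrow> u' \<approx> u'' \<Longrightarrow> u \<approx> u''"
  unfolding equiv_J_def
  using J_closed(2)[of "Poly_Mapping.single u 1 - Poly_Mapping.single u' 1"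
      "Poly_Mapping.single u' 1 - Poly_Mapping.single u'' 1"] by simp

lemma equiv_J_edge:
  assumes "{i, j} \<in> E" "w \<in> monoms V"
  shows "w + xm i + ym j \<approx> w + xm j + ym i"
proof -
  interpret R: cring "xy_poly_ring V :: ('v, 'k) mpoly ring" by (rule cring_xy_poly_ring)
  have "(edge_binomial i j :: ('v, 'k) mpoly) \<in> J"
    unfolding J_eq
    by (rule subsetD[OF R.genideal_self]) (use edge_binomials_subset assms in auto)
  then have "Poly_Mapping.single w 1 * edge_binomial i j \<in> J"
    using assms by (intro J_closed xy_poly_carrier_single)
  then show ?thesis by (simp add: equiv_J_def single_times_edge_binomial)
qed

text \<open>
  An \<open>x\<close> at \<open>i\<close> and a \<open>y\<close> at \<open>j\<close> can trade places along a path in the support: whichever variable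
  sits at the next vertex of the path serves as the intermediary.
\<close>

lemma equiv_J_path:
  assumes "(i, j) \<in> (edge_rel E S)\<^sup>*" and j: "j \<in> V"
    and "w \<in> monoms V" "support (multidegree (w + xm i + ym j)) = S"
  shows "w + xm i + ym j \<approx> w + xm j + ym i"
  using assms(1,3,4)
proof (induction arbitrary: w rule: converse_rtrancl_induct)
  case base
  then show ?case by (simp add: equiv_J_refl)
next
  case (step i k)
  have ik: "{i, k} \<in> E" "k \<in> S" "i \<in> S" using step.hyps by (auto simp: edge_rel_def)
  then have V: "i \<in> V" "k \<in> V" using E_subset by auto
  show ?case
  proof (cases "k = i \<or> k = j")
    case True
    \<comment> \<open>For \<open>k = i\<close> the induction hypothesis is the claim itself; for
      \<open>k = j\<close> a single exchange along the edge suffices.\<close>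
    then show ?thesis using step ik equiv_J_edge by blast
  next
    case False
    then have "multidegree w k \<noteq> 0"
      using ik(2) unfolding step.prems(2)[symmetric]
      by (auto simp: support_def multidegree_def lookup_add)
    then consider "Poly_Mapping.lookup w (XVar k) \<noteq> 0" | "Poly_Mapping.lookup w (YVar k) \<noteq> 0"
      by (auto simp: multidegree_def)
    then show ?thesis
    proof cases
      case 1
      \<comment> \<open>With an x at \<open>k\<close>: first trade it against the y at
        \<open>j\<close> by induction, then trade the x at \<open>i\<close> against the y now at
        \<open>k\<close>, which restores the x at \<open>k\<close>.\<close>
      define w' where "w' = w - xm k"
      have w: "w = w' + xm k"
        using 1 by (intro monom_eqI) (auto simp: w'_def lookup_add lookup_minus)
      have w': "w' \<in> monoms V"
        using step.prems(1) by (simp add: w'_def monoms_diff)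
      have "support (multidegree ((w' + xm i) + xm k + ym j)) = S"
        using step.prems(2) by (simp add: w ac_simps)
      then have "(w' + xm i) + xm k + ym j \<approx> (w' + xm i) + xm j + ym k"
        by (intro step.IH monoms_add w' xm_in_monoms ym_in_monoms V)
      also have "(w' + xm i) + xm j + ym k = (w' + xm j) + xm i + ym k"
        by (simp only: ac_simps)
      also have "(w' + xm j) + xm i + ym k \<approx> (w' + xm j) + xm k + ym i"
        by (intro equiv_J_edge monoms_add w' xm_in_monoms ym_in_monoms j ik)
      finally show ?thesis
        unfolding w by (simp only: ac_simps)
    next
      case 2
      \<comment> \<open>With a y at \<open>k\<close> the order is reversed: the edge exchange comes
        first, and it keeps the support, so the induction hypothesis still applies.\<close>
      define w' where "w' = w - ym k"
      have w: "w = w' + ym k"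
        using 2 by (intro monom_eqI) (auto simp: w'_def lookup_add lookup_minus)
      have w': "w' \<in> monoms V"
        using step.prems(1) by (simp add: w'_def monoms_diff)
      have S: "support (multidegree ((w' + ym i) + xm k + ym j)) = S"
        unfolding step.prems(2)[symmetric] w
        by (auto simp: support_def multidegree_def lookup_add)
      have "(w' + ym j) + xm i + ym k \<approx> (w' + ym j) + xm k + ym i"
        by (intro equiv_J_edge monoms_add w' xm_in_monoms ym_in_monoms j ik)
      also have "(w' + ym j) + xm k + ym i = (w' + ym i) + xm k + ym j"
        by (simp only: ac_simps)
      also have "(w' + ym i) + xm k + ym j \<approx> (w' + ym i) + xm j + ym k"
        by (intro step.IH S monoms_add w' xm_in_monoms ym_in_monoms V)
      finally show ?thesis
        unfolding w by (simp only: ac_simps)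
    qed
  qed
qed

text \<open>As long as \<open>u\<close> has a surplus of x over \<open>u'\<close> at some vertex,
  its component contains a vertex with a deficit, and an exchange along a path between them brings
  \<open>u\<close> closer to \<open>u'\<close>.\<close>

lemma monom_class_eq_imp_equiv_J:
  assumes "u \<in> monoms V" "u' \<in> monoms V" "monom_class E u = monom_class E u'"
  shows "u \<approx> u'"
  using assms
\<comment> \<open>Subtraction on naturals truncates, so the measure is the total surplus only;
  deficits do not count against it.\<close>
proof (induction "\<Sum>v\<in>V. Poly_Mapping.lookup u (XVar v) - Poly_Mapping.lookup u' (XVar v)"
    arbitrary: u rule: less_induct)
  case less
  define S where "S = support (multidegree u)"
  define p where "p v = Poly_Mapping.lookup u (XVar v)" for v
  define p' where "p' v = Poly_Mapping.lookup u' (XVar v)" for v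
  have md: "multidegree u' = multidegree u"
    using less.prems(3) by (simp add: monom_class_def)
  have csum: "sum p (component E S v) = sum p' (component E S v)" if "v \<in> S" for v
  proof -
    have "snd (monom_class E u) (component E S v) = snd (monom_class E u') (component E S v)"
      using less.prems(3) by simp
    then show ?thesis using that by (simp add: monom_class_def S_def p_def p'_def md)
  qed
  have fin: "finite (component E S v)" if "v \<in> S" for v
    using that finite_support_multidegree[of u] by (auto simp: S_def intro: finite_component)
  have zero: "p v = 0" "p' v = 0" if "v \<notin> S" for v
    using that fun_cong[OF md, of v] by (auto simp: S_def support_def multidegree_def p_def p'_def)
  show ?case
  proof (cases "\<forall>v. p v \<le> p' v")
    case True
    \<comment> \<open>Without surplus anywhere, equal sums over each component force equality at
      each vertex.\<close>
    have "p v = p' v" for v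
    proof (cases "v \<in> S")
      case True
      show ?thesis
      proof (rule ccontr)
        assume "p v \<noteq> p' v"
        then have "sum p (component E S v) < sum p' (component E S v)"
          using \<open>\<forall>v. p v \<le> p' v\<close> component_self[of v E S]
          by (intro sum_strict_mono_ex1) (auto simp: fin True order_less_le intro!: bexI[of _ v])
        then show False using csum True by simp
      qed
    qed (simp add: zero)
    then have "u = u'"
      using fun_cong[OF md] by (intro monom_eqI) (auto simp: multidegree_def p_def p'_def)
    then show ?thesis by (simp add: equiv_J_refl)
  next
    case False
    then obtain i where i: "p' i < p i" by (auto simp: not_le)
    then have iS: "i \<in> S" using zero by fastforce
    have "\<exists>j\<in>component E S i. p j < p' j"
    proof (rule ccontr)
      assume "\<not> ?thesis"
      then have "sum p' (component E S i) < sum p (component E S i)"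
        using i component_self[of i E S]
        by (intro sum_strict_mono_ex1) (auto simp: fin iS not_less)
      then show False using csum iS by simp
    qed
    then obtain j where j: "j \<in> component E S i" "p j < p' j" by blast
    have ne: "i \<noteq> j" using i j by auto
    have V: "i \<in> V" "j \<in> V"
      using support_multidegree_subset[OF less.prems(1)] iS j component_subset[OF iS, of E] S_def by auto
    \<comment> \<open>The multidegrees agree and \<open>u\<close> has fewer x at \<open>j\<close>
      than \<open>u'\<close>, so \<open>u\<close> has a y there to trade.\<close>
    have yj: "Poly_Mapping.lookup u (YVar j) > 0"
      using j(2) fun_cong[OF md, of j] by (auto simp: p_def p'_def multidegree_def)
    define w where "w = u - xm i - ym j"
    have u: "u = w + xm i + ym j"
      using i yj by (intro monom_eqI) (auto simp: w_def p_def lookup_add lookup_minus)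
    have w: "w \<in> monoms V"
      using less.prems(1) by (simp add: w_def monoms_diff)
    have path: "(i, j) \<in> (edge_rel E (support (multidegree (w + xm i + ym j))))\<^sup>*"
      using j by (simp add: component_def S_def flip: u)
    define u2 where "u2 = w + xm j + ym i"
    have "u \<approx> u2"
      using equiv_J_path[OF path V(2) w refl] by (simp add: u u2_def)
    also have "u2 \<approx> u'"
    proof (rule less.hyps)
      show "monom_class E u2 = monom_class E u'"
        using monom_class_swap[OF path] less.prems(3) by (simp add: u u2_def)
      show "u2 \<in> monoms V"
        unfolding u2_def using V by (intro monoms_add w xm_in_monoms ym_in_monoms)
      have u2p: "Poly_Mapping.lookup u2 (XVar v) = (if v = i then p v - 1 else if v = j then p v + 1 else p v)" for v
        using ne i by (auto simp: p_def u u2_def lookup_add)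
      \<comment> \<open>The term at \<open>i\<close> drops by one, and the term at \<open>j\<close>
        stays 0 because there was a deficit at \<open>j\<close>.\<close>
      show "(\<Sum>v\<in>V. Poly_Mapping.lookup u2 (XVar v) - Poly_Mapping.lookup u' (XVar v)) <
          (\<Sum>v\<in>V. Poly_Mapping.lookup u (XVar v) - Poly_Mapping.lookup u' (XVar v))"
        using i j(2) V finite_V unfolding u2p p_def[symmetric] p'_def[symmetric]
        by (intro sum_strict_mono_ex1) auto
    qed (rule less.prems)
    finally show ?thesis .
  qed
qed

end

section \<open>Counting the classes\<close>

text \<open>The multidegrees of total degree \<open>d\<close>. Functions vanish off
  \<open>V\<close>, as \<open>multidegree\<close> does for monomials in
  \<open>monoms V\<close>.\<close>

definition funs_sum :: "'v set \<Rightarrow> nat \<Rightarrow> ('v \<Rightarrow> nat) set" where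
  "funs_sum V d = {a. support a \<subseteq> V \<and> sum a V = d}"

lemma finite_funs_sum:
  assumes "finite V"
  shows "finite (funs_sum V d)"
proof (rule finite_subset)
  show "funs_sum V d \<subseteq> {a. (\<forall>v. a v \<in> (if v \<in> V then {..d} else {0})) }"
    using assms by (auto simp: funs_sum_def support_def intro: member_le_sum)
  have "{a. (\<forall>v. a v \<in> (if v \<in> V then {..d} else {0::nat}))} =
      {a. \<forall>v. (v \<in> V \<longrightarrow> a v \<in> {..d}) \<and> (v \<notin> V \<longrightarrow> a v = 0)}"
    by auto
  then show "finite {a. (\<forall>v. a v \<in> (if v \<in> V then {..d} else {0::nat}))}"
    using finite_set_of_finite_funs[OF assms, of "{..d}" 0] by simp
qed

text \<open>Filling the vertices greedily works. It realises any admissible total x-degree on a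
  component.\<close>

lemma exists_sum_le:
  fixes a :: "'v \<Rightarrow> nat"
  assumes "finite C" "n \<le> sum a C"
  shows "\<exists>p. (\<forall>v. p v \<le> a v) \<and> sum p C = n"
  using assms
proof (induction C arbitrary: n rule: finite_induct)
  case empty
  then show ?case by (intro exI[of _ "\<lambda>_. 0"]) auto
next
  case (insert x C)
  have "n - min n (a x) \<le> sum a C" using insert by auto
  from insert.IH[OF this] obtain p where p: "\<forall>v. p v \<le> a v" "sum p C = n - min n (a x)" by auto
  have "sum (p(x := min n (a x))) C = sum p C"
    using insert.hyps by (intro sum.cong) auto
  then show ?case
    using p insert.hyps by (intro exI[of _ "p(x := min n (a x))"]) auto
qed

lemma monom_deg_eq:
  assumes "finite V" "u \<in> monoms V"
  shows "monom_deg u = sum (multidegree u) V"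
proof -
  have "monom_deg u = (\<Sum>z\<in>XVar ` V \<union> YVar ` V. Poly_Mapping.lookup u z)"
    unfolding monom_deg_def
    using assms by (intro sum.mono_neutral_left) (auto simp: monoms_def in_keys_iff)
  also have "\<dots> = (\<Sum>z\<in>XVar ` V. Poly_Mapping.lookup u z) + (\<Sum>z\<in>YVar ` V. Poly_Mapping.lookup u z)"
    using assms by (intro sum.union_disjoint) auto
  also have "\<dots> = sum (multidegree u) V"
    by (subst (1 2) sum.reindex) (auto simp: inj_on_def multidegree_def sum.distrib)
  finally show ?thesis .
qed

text \<open>Only realisability needs an argument: every component admits a splitting of its
  exponents into x and y parts with the prescribed x total, and splittings on different components
  do not interact.\<close>

lemma image_monom_class:
  assumes V: "finite V"
  shows "monom_class E ` {u \<in> monoms V. monom_deg u = d} =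
    (SIGMA a:funs_sum V d. PiE (components E (support a)) (\<lambda>C. {..sum a C}))"
proof (intro equalityI subsetI)
  fix x assume "x \<in> monom_class E ` {u \<in> monoms V. monom_deg u = d}"
  then obtain u where u: "u \<in> monoms V" "monom_deg u = d" and x: "x = monom_class E u" by auto
  then have "multidegree u \<in> funs_sum V d"
    using V support_multidegree_subset by (auto simp: funs_sum_def monom_deg_eq)
  moreover have "(\<Sum>v\<in>C. Poly_Mapping.lookup u (XVar v)) \<le> sum (multidegree u) C" for C
    by (intro sum_mono) (simp add: multidegree_def)
  ultimately show "x \<in> (SIGMA a:funs_sum V d. PiE (components E (support a)) (\<lambda>C. {..sum a C}))"
    by (auto simp: x monom_class_def)
next
  fix x assume "x \<in> (SIGMA a:funs_sum V d. PiE (components E (support a)) (\<lambda>C. {..sum a C}))"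
  then obtain a f where x: "x = (a, f)" and a: "a \<in> funs_sum V d"
    and f: "f \<in> PiE (components E (support a)) (\<lambda>C. {..sum a C})" by auto
  have suppV: "support a \<subseteq> V" using a by (simp add: funs_sum_def)
  have "\<exists>p. (\<forall>v. p v \<le> a v) \<and> sum p C = f C" if "C \<in> components E (support a)" for C
  proof (rule exists_sum_le)
    show "finite C" using that finite_subset[OF suppV V] by (auto intro: finite_component)
    show "f C \<le> sum a C" using f that by (auto simp: PiE_iff)
  qed
  then obtain P where P: "\<And>C v. C \<in> components E (support a) \<Longrightarrow> P C v \<le> a v"
    "\<And>C. C \<in> components E (support a) \<Longrightarrow> sum (P C) C = f C" by metis
  \<comment> \<open>The splittings of the components are glued; each vertex of the support looks up
    its own component.\<close>
  define p where "p v = (if v \<in> support a then P (component E (support a) v) v else 0)" for v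
  have p_le: "p v \<le> a v" for v using P by (simp add: p_def)
  define u where "u = (\<Sum>v\<in>V. Poly_Mapping.single (XVar v) (p v) + Poly_Mapping.single (YVar v) (a v - p v))"
  have lX: "Poly_Mapping.lookup u (XVar v) = p v" for v
    using V suppV by (auto simp: u_def lookup_sum lookup_add lookup_single when_def sum.distrib p_def)
  have lY: "Poly_Mapping.lookup u (YVar v) = a v - p v" for v
  proof -
    have "v \<notin> V \<Longrightarrow> a v = 0" using suppV by (auto simp: support_def)
    then show ?thesis
      using V by (auto simp: u_def lookup_sum lookup_add lookup_single when_def sum.distrib)
  qed
  have md: "multidegree u = a"
    using p_le by (auto simp: multidegree_def lX lY)
  have "u \<in> monoms V"
  proof -
    have V: "v \<in> V" if "0 < a v" for v using that suppV by (auto simp: support_def)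
    have "z \<in> XVar ` V \<union> YVar ` V" if "Poly_Mapping.lookup u z \<noteq> 0" for z
    proof (cases z)
      case (XVar v)
      then show ?thesis using that V[of v] p_le[of v] by (simp add: lX)
    next
      case (YVar v)
      then show ?thesis using that V[of v] by (simp add: lY)
    qed
    then show ?thesis by (auto simp: monoms_def in_keys_iff)
  qed
  moreover from this have "monom_deg u = d"
    using a V by (simp add: monom_deg_eq md funs_sum_def)
  moreover have "monom_class E u = x"
  proof -
    have "sum p C = f C" if C: "C \<in> components E (support a)" for C
    proof -
      have "sum p C = sum (P C) C"
      proof (rule sum.cong)
        fix v assume v: "v \<in> C"
        obtain v0 where v0: "v0 \<in> support a" "C = component E (support a) v0" using C by auto
        then have "v \<in> support a" "component E (support a) v = C"
          using v component_subset component_eq by fastforce+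
        then show "p v = P C v" by (simp add: p_def)
      qed simp
      then show ?thesis using P C by simp
    qed
    then show ?thesis
      using f by (auto simp: monom_class_def md lX x PiE_iff extensional_def restrict_def)
  qed
  ultimately show "x \<in> monom_class E ` {u \<in> monoms V. monom_deg u = d}" by blast
qed

text \<open>The cardinality of the fibre over \<open>a\<close> in
  \<open>image_monom_class\<close>.\<close>

definition class_count :: "'v set set \<Rightarrow> ('v \<Rightarrow> nat) \<Rightarrow> nat" where
  "class_count E a = (\<Prod>C\<in>components E (support a). sum a C + 1)"

text \<open>The invariants vanish on the ideal and separate monomials modulo it, so
  \<open>dim_quotient_part\<close> reduces each dimension to counting values of
  \<open>monom_class\<close>.\<close>

lemma quotient_hilbert_series_binomial_edge_ideal:
  assumes "finite (verts G)" "\<Union> (edges G) \<subseteq> verts G"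
  shows "quotient_hilbert_series (verts G) (binomial_edge_ideal G :: ('v, 'k::field) mpoly set) =
    Abs_fps (\<lambda>d. \<Sum>a\<in>funs_sum (verts G) d. of_nat (class_count (edges G) a))"
proof -
  define V where "V = verts G"
  define E where "E = edges G"
  define J :: "('v, 'k) mpoly set" where "J = binomial_edge_ideal G"
  interpret edge_ideal V E J
    by unfold_locales (use assms in \<open>auto simp: V_def E_def J_def binomial_edge_ideal_def\<close>)
  have fin: "finite (PiE (components E (support a)) (\<lambda>C. {..sum a C}))"
    and card: "card (PiE (components E (support a)) (\<lambda>C. {..sum a C})) = class_count E a"
    if "a \<in> funs_sum V d" for a d
  proof -
    have "finite (components E (support a))"
      using that finite_V by (auto simp: funs_sum_def intro: finite_subset)
    then show "finite (PiE (components E (support a)) (\<lambda>C. {..sum a C}))"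
      "card (PiE (components E (support a)) (\<lambda>C. {..sum a C})) = class_count E a"
      by (auto intro: finite_PiE simp: card_PiE class_count_def)
  qed
  have "ring.dim (xy_poly_ring V Quot J) (quotient_scalars V J) (quotient_part V J d) =
    (\<Sum>a\<in>funs_sum V d. class_count E a)" for d
  proof -
    have "ring.dim (xy_poly_ring V Quot J) (quotient_scalars V J) (quotient_part V J d) =
        card (monom_class E ` {u \<in> monoms V. monom_deg u = d})"
    proof (rule dim_quotient_part[OF ideal_J class_coeff_J])
      show "finite (monom_class E ` {u \<in> monoms V. monom_deg u = d})"
        unfolding image_monom_class[OF finite_V]
        by (rule finite_SigmaI) (auto intro: finite_funs_sum finite_V fin)
    qed (use monom_class_eq_imp_equiv_J in \<open>auto simp: equiv_J_def\<close>)
    also have "\<dots> = (\<Sum>a\<in>funs_sum V d. class_count E a)"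
      unfolding image_monom_class[OF finite_V]
      by (subst card_SigmaI) (auto intro: finite_funs_sum finite_V fin simp: card cong: sum.cong)
    finally show ?thesis .
  qed
  then show ?thesis
    by (simp add: quotient_hilbert_series_def hilbert_series_def V_def E_def J_def)
qed

section \<open>Generating functions\<close>

text \<open>A multidegree on a disjoint union is the same as a pair of multidegrees on the parts,
  with degrees adding up: a Cauchy product. The locality of \<open>F\<close> and \<open>H\<close>
  allows cutting off the other part.\<close>

lemma funs_sum_fps_mult:
  fixes F H :: "('v \<Rightarrow> nat) \<Rightarrow> 'a::comm_ring_1"
  assumes fin: "finite I" "finite J" and disj: "I \<inter> J = {}"
    and F: "\<And>a b. (\<And>v. v \<in> I \<Longrightarrow> a v = b v) \<Longrightarrow> F a = F b"
    and H: "\<And>a b. (\<And>v. v \<in> J \<Longrightarrow> a v = b v) \<Longrightarrow> H a = H b"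
  shows "Abs_fps (\<lambda>d. \<Sum>a\<in>funs_sum (I \<union> J) d. F a * H a) =
    Abs_fps (\<lambda>d. \<Sum>a\<in>funs_sum I d. F a) * Abs_fps (\<lambda>d. \<Sum>a\<in>funs_sum J d. H a)"
proof (rule fps_ext)
  fix d
  let ?T = "SIGMA i:{0..d}. funs_sum I i \<times> funs_sum J (d - i)"
  let ?cut = "\<lambda>A a v. if v \<in> A then a v else (0::nat)"
  have cut: "sum (?cut A a) A = sum a A" for A a by (rule sum.cong) auto
  have dJ: "v \<in> J \<Longrightarrow> v \<notin> I" for v using disj by auto
  have "(\<Sum>a\<in>funs_sum (I \<union> J) d. F a * H a) = (\<Sum>(i, a, b)\<in>?T. F a * H b)"
  proof (rule sum.reindex_bij_witness[of _
        "\<lambda>(i, a, b) v. if v \<in> I then a v else b v" "\<lambda>c. (sum c I, ?cut I c, ?cut J c)"], goal_cases)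
    case (1 c)
    then show ?case by (auto simp: funs_sum_def support_def fun_eq_iff)
  next
    case (2 c)
    then have "sum c I + sum c J = d"
      using fin disj by (simp add: funs_sum_def sum.union_disjoint)
    then show ?case by (auto simp: funs_sum_def support_def cut)
  next
    case (3 t)
    then obtain i a b where t: "t = (i, a, b)" "a \<in> funs_sum I i" "b \<in> funs_sum J (d - i)" by auto
    have "sum (\<lambda>v. if v \<in> I then a v else b v) I = i"
      using t by (auto simp: funs_sum_def intro!: sum.cong)
    moreover have "a v = 0" if "v \<notin> I" for v
      using t(2) that by (auto simp: funs_sum_def support_def)
    moreover have "b v = 0" if "v \<notin> J" for v
      using t(3) that by (auto simp: funs_sum_def support_def)
    ultimately show ?case
      unfolding t(1) using dJ by (auto simp: fun_eq_iff)
  next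
    case (4 t)
    then obtain i a b where t: "t = (i, a, b)" "i \<le> d" "a \<in> funs_sum I i" "b \<in> funs_sum J (d - i)" by auto
    let ?c = "\<lambda>v. if v \<in> I then a v else b v"
    have "sum ?c (I \<union> J) = sum ?c I + sum ?c J" using fin disj by (simp add: sum.union_disjoint)
    also have "sum ?c I = sum a I" by (rule sum.cong) auto
    also have "sum ?c J = sum b J" by (rule sum.cong) (use dJ in auto)
    finally have "sum ?c (I \<union> J) = d" using t by (simp add: funs_sum_def)
    moreover have "support ?c \<subseteq> I \<union> J" using t(3,4) by (auto simp: funs_sum_def support_def)
    ultimately show ?case by (simp add: t(1) funs_sum_def)
  next
    case (5 c)
    have "F (?cut I c) = F c" by (rule F) auto
    moreover have "H (?cut J c) = H c" by (rule H) auto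
    ultimately show ?case by simp
  qed
  also have "\<dots> = (\<Sum>i=0..d. (\<Sum>a\<in>funs_sum I i. F a) * (\<Sum>b\<in>funs_sum J (d - i). H b))"
    using fin by (subst sum.Sigma[symmetric])
      (auto simp: finite_funs_sum sum_product sum.cartesian_product)
  finally show "fps_nth (Abs_fps (\<lambda>d. \<Sum>a\<in>funs_sum (I \<union> J) d. F a * H a)) d =
      fps_nth (Abs_fps (\<lambda>d. \<Sum>a\<in>funs_sum I d. F a) * Abs_fps (\<lambda>d. \<Sum>a\<in>funs_sum J d. H a)) d"
    by (simp add: fps_mult_nth)
qed

lemma funs_sum_empty: "funs_sum {} d = (if d = 0 then {\<lambda>_. 0} else {})"
  by (auto simp: funs_sum_def support_def)

lemma funs_sum_singleton: "funs_sum {x} d = {\<lambda>v. if v = x then d else 0}"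
  by (auto simp: funs_sum_def support_def fun_eq_iff split: if_splits)

text \<open>Vertices are split off one at a time with \<open>funs_sum_fps_mult\<close>.\<close>

lemma funs_sum_fps_prod:
  fixes g :: "'v \<Rightarrow> nat \<Rightarrow> 'a::comm_ring_1"
  assumes "finite V"
  shows "Abs_fps (\<lambda>d. \<Sum>a\<in>funs_sum V d. \<Prod>v\<in>V. g v (a v)) = (\<Prod>v\<in>V. Abs_fps (g v))"
  using assms
proof (induction V rule: finite_induct)
  case empty
  then show ?case by (intro fps_ext) (simp add: funs_sum_empty)
next
  case (insert x V)
  have "Abs_fps (\<lambda>d. \<Sum>a\<in>funs_sum (insert x V) d. \<Prod>v\<in>insert x V. g v (a v)) =
      Abs_fps (\<lambda>d. \<Sum>a\<in>funs_sum ({x} \<union> V) d. g x (a x) * (\<Prod>v\<in>V. g v (a v)))"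
    using insert by simp
  also have "\<dots> = Abs_fps (\<lambda>d. \<Sum>a\<in>funs_sum {x} d. g x (a x)) *
      Abs_fps (\<lambda>d. \<Sum>a\<in>funs_sum V d. \<Prod>v\<in>V. g v (a v))"
    using insert by (intro funs_sum_fps_mult) (auto intro!: prod.cong)
  finally show ?case using insert by (simp add: funs_sum_singleton)
qed

section \<open>Geometric series as factors of single vertices\<close>

abbreviation geo :: "rat fps" where "geo \<equiv> Abs_fps (\<lambda>_. 1)"

lemma geo_times: "geo * (1 - fps_X) = 1"
  by (rule fps_ext) (auto simp: right_diff_distrib)

text \<open>The factor of an isolated vertex with unrestricted exponent: exponent n allows n + 1
  classes.\<close>

lemma geo_square: "Abs_fps (\<lambda>n. of_nat n + 1) = geo ^ 2"
  by (rule fps_ext) (simp add: power2_eq_square fps_mult_nth)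

text \<open>The factor of a vertex forced into the support inside the large component, where the
  class count is attached to the whole component.\<close>

lemma fps_pos_eq: "Abs_fps (\<lambda>n. of_bool (0 < n)) = fps_X * geo"
  by (rule fps_ext) auto

text \<open>The factor of an isolated vertex forced into the support.\<close>

lemma fps_pos_square_eq: "Abs_fps (\<lambda>n. of_bool (0 < n) * (of_nat n + 1)) = geo ^ 2 - 1"
  unfolding geo_square[symmetric] by (rule fps_ext) auto

lemma fps_zero_eq: "Abs_fps (\<lambda>n. of_bool (n = 0) * (of_nat n + 1)) = (1 :: rat fps)"
  by (rule fps_ext) auto

lemma fps_deriv_geo: "fps_deriv geo = geo ^ 2"
  unfolding geo_square[symmetric] by (rule fps_ext) simp

section \<open>Components of induced subgraphs of \<open>F\<^sub>m\<close>\<close>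

text \<open>All components are singletons, and vertices outside the support contribute the factor
  1.\<close>

lemma class_count_no_edges:
  assumes "finite V" "support a \<subseteq> V" "edge_rel E (support a) = {}"
  shows "class_count E a = (\<Prod>v\<in>V. a v + 1)"
proof -
  have "component E (support a) v = {v}" for v
    using assms by (simp add: component_def)
  then have "class_count E a = (\<Prod>C\<in>(\<lambda>v. {v}) ` support a. sum a C + 1)"
    by (simp add: class_count_def)
  also have "\<dots> = (\<Prod>v\<in>support a. a v + 1)"
    by (subst prod.reindex) auto
  also have "\<dots> = (\<Prod>v\<in>V. a v + 1)"
    using assms by (intro prod.mono_neutral_left) (auto simp: support_def)
  finally show ?thesis .
qed

text \<open>The component of \<open>c\<close> is the part of the support in \<open>C\<close>, and
  the rest of the support is isolated. Vertices outside the support add 0 to the sum over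
  \<open>C\<close> and multiply the product by 1.\<close>

lemma class_count_one_component:
  assumes V: "finite V" "support a \<subseteq> V" "C \<subseteq> V" and c: "c \<in> C" "c \<in> support a"
    and connected: "\<And>v. v \<in> C \<inter> support a \<Longrightarrow> (c, v) \<in> (edge_rel E (support a))\<^sup>*"
    and closed: "edge_rel E (support a) \<subseteq> C \<times> C"
  shows "class_count E a = (sum a C + 1) * (\<Prod>v\<in>V - C. a v + 1)"
proof -
  define W where "W = support a"
  have path: "v = w \<or> (v \<in> C \<and> w \<in> C)" if "(v, w) \<in> (edge_rel E W)\<^sup>*" for v w
    using that by (induction rule: rtrancl_induct) (use closed in \<open>auto simp: W_def\<close>)
  have finW: "finite W" using V finite_subset W_def by auto
  have out: "component E W v = {v}" if "v \<notin> C" for v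
    using path that by (auto simp: component_def)
  have "component E W c = W \<inter> C"
    using connected component_subset[of c W E] path[of c] c
    by (auto simp: component_def W_def)
  then have inn: "component E W v = W \<inter> C" if "v \<in> W \<inter> C" for v
    using that component_eq[of v E W c] by simp
  have "components E W = component E W ` (W \<inter> C) \<union> component E W ` (W - C)" by auto
  also have "component E W ` (W \<inter> C) = {W \<inter> C}" using inn c by (auto simp: W_def)
  also have "component E W ` (W - C) = (\<lambda>v. {v}) ` (W - C)"
    by (rule image_cong) (use out in auto)
  finally have "components E W = insert (W \<inter> C) ((\<lambda>v. {v}) ` (W - C))" by simp
  \<comment> \<open>The large component is never one of the listed singletons, so its factor can be
    split off.\<close>
  moreover have "W \<inter> C \<notin> (\<lambda>v. {v}) ` (W - C)" by auto
  ultimately have "class_count E a =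
      (sum a (W \<inter> C) + 1) * (\<Prod>D\<in>(\<lambda>v. {v}) ` (W - C). sum a D + 1)"
    using finW by (simp add: class_count_def flip: W_def)
  also have "sum a (W \<inter> C) = sum a C"
    using V finite_subset by (intro sum.mono_neutral_left) (auto simp: W_def support_def)
  also have "(\<Prod>D\<in>(\<lambda>v. {v}) ` (W - C). sum a D + 1) = (\<Prod>v\<in>W - C. a v + 1)"
    by (subst prod.reindex) auto
  also have "\<dots> = (\<Prod>v\<in>V - C. a v + 1)"
    using V by (intro prod.mono_neutral_left) (auto simp: W_def support_def)
  finally show ?thesis .
qed

section \<open>Edges and strata of multidegrees for the bipartite graph\<close>

lemma edges_F_graph_iff:
  "{v, w} \<in> edges (F_graph m) \<longleftrightarrow>
    (\<exists>i j. 1 \<le> i \<and> i \<le> j \<and> j \<le> m \<and> (v = 2 * i \<and> w = 2 * j - 1 \<or> v = 2 * j - 1 \<and> w = 2 * i))"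
  by (auto simp: edges_def F_graph_def doubleton_eq_iff) (metis atLeastAtMost_iff order_trans)+

lemma verts_F_graph: "verts (F_graph m) = {1..2 * m}"
  by (simp add: verts_def F_graph_def)

lemma edges_F_graph_subset: "\<Union> (edges (F_graph m)) \<subseteq> verts (F_graph m)"
  by (auto simp: edges_def verts_def F_graph_def)

text \<open>\<open>\<alpha>\<close> is the first even vertex \<open>2\<alpha>\<close> of the support, and \<open>\<beta>\<close> the last odd vertex \<open>2\<beta> - 1\<close>
  adjacent to it; \<open>\<alpha> = m + 1\<close> and \<open>\<beta> = 0\<close> stand for nonexistence.\<close>

definition first_even :: "nat \<Rightarrow> (nat \<Rightarrow> nat) \<Rightarrow> nat" where
  "first_even m a = Min (insert (m + 1) {i \<in> {1..m}. a (2 * i) \<noteq> 0})"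

definition last_odd :: "nat \<Rightarrow> (nat \<Rightarrow> nat) \<Rightarrow> nat" where
  "last_odd m a = Max (insert 0 {j \<in> {first_even m a..m}. a (2 * j - 1) \<noteq> 0})"

lemma first_even_range: "first_even m a \<in> {1..m + 1}"
proof -
  have "first_even m a \<in> insert (m + 1) {i \<in> {1..m}. a (2 * i) \<noteq> 0}"
    unfolding first_even_def by (rule Min_in) auto
  then show ?thesis by auto
qed

lemma last_odd_range: "last_odd m a \<in> insert 0 {first_even m a..m}"
proof -
  have "last_odd m a \<in> insert 0 {j \<in> {first_even m a..m}. a (2 * j - 1) \<noteq> 0}"
    unfolding last_odd_def by (rule Max_in) auto
  then show ?thesis by auto
qed

text \<open>Rewriting the minimum as conditions on single vertices is what lets the series of a
  stratum factor.\<close>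

lemma first_even_eq_iff:
  assumes "\<alpha> \<in> {1..m + 1}"
  shows "first_even m a = \<alpha> \<longleftrightarrow>
    (\<forall>i\<in>{1..m}. i < \<alpha> \<longrightarrow> a (2 * i) = 0) \<and> (\<alpha> \<le> m \<longrightarrow> a (2 * \<alpha>) \<noteq> 0)"
proof -
  define A where "A = {i \<in> {1..m}. a (2 * i) \<noteq> 0}"
  have "first_even m a = \<alpha> \<longleftrightarrow> \<alpha> \<in> insert (m + 1) A \<and> (\<forall>i\<in>insert (m + 1) A. \<alpha> \<le> i)"
    unfolding first_even_def A_def by (rule Min_eq_iff) auto
  also have "\<alpha> \<in> insert (m + 1) A \<longleftrightarrow> (\<alpha> \<le> m \<longrightarrow> a (2 * \<alpha>) \<noteq> 0)"
    using assms by (auto simp: A_def)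
  also have "(\<forall>i\<in>insert (m + 1) A. \<alpha> \<le> i) \<longleftrightarrow> (\<forall>i\<in>{1..m}. i < \<alpha> \<longrightarrow> a (2 * i) = 0)"
    using assms by (auto simp: A_def not_less[symmetric])
  finally show ?thesis by blast
qed

text \<open>Since \<open>first_even\<close> is at least 1, the value 0 cannot come from an actual
  index.\<close>

lemma last_odd_eq_0_iff:
  assumes "first_even m a = \<alpha>"
  shows "last_odd m a = 0 \<longleftrightarrow> (\<forall>j\<in>{1..m}. \<alpha> \<le> j \<longrightarrow> a (2 * j - 1) = 0)"
  unfolding last_odd_def assms using first_even_range[of m a] assms
  by (subst Max_eq_iff) auto

lemma last_odd_eq_iff:
  assumes "first_even m a = \<alpha>" "\<alpha> \<le> \<beta>" "\<beta> \<le> m"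
  shows "last_odd m a = \<beta> \<longleftrightarrow>
    a (2 * \<beta> - 1) \<noteq> 0 \<and> (\<forall>j\<in>{1..m}. \<beta> < j \<longrightarrow> a (2 * j - 1) = 0)"
proof -
  have \<alpha>: "1 \<le> \<alpha>" using first_even_range[of m a] assms by auto
  define A where "A = {j \<in> {\<alpha>..m}. a (2 * j - 1) \<noteq> 0}"
  have "last_odd m a = \<beta> \<longleftrightarrow> \<beta> \<in> insert 0 A \<and> (\<forall>j\<in>insert 0 A. j \<le> \<beta>)"
    unfolding last_odd_def A_def assms(1) by (rule Max_eq_iff) auto
  also have "\<beta> \<in> insert 0 A \<longleftrightarrow> a (2 * \<beta> - 1) \<noteq> 0"
    using assms \<alpha> by (auto simp: A_def)
  also have "(\<forall>j\<in>insert 0 A. j \<le> \<beta>) \<longleftrightarrow> (\<forall>j\<in>{1..m}. \<beta> < j \<longrightarrow> a (2 * j - 1) = 0)"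
  proof (intro iffI ballI impI)
    fix j assume "\<forall>j\<in>insert 0 A. j \<le> \<beta>" "j \<in> {1..m}" "\<beta> < j"
    then have "j \<notin> A" by auto
    then show "a (2 * j - 1) = 0" using \<open>j \<in> {1..m}\<close> \<open>\<beta> < j\<close> assms by (auto simp: A_def)
  next
    fix j assume "\<forall>j\<in>{1..m}. \<beta> < j \<longrightarrow> a (2 * j - 1) = 0" "j \<in> insert 0 A"
    then show "j \<le> \<beta>" using \<alpha> by (cases "\<beta> < j") (auto simp: A_def)
  qed
  finally show ?thesis .
qed

text \<open>An induced edge joins \<open>2 * i\<close> and \<open>2 * j - 1\<close> with i \<le> j;
  then \<alpha> \<le> i \<le> j, but no odd vertex of such an index is in the support.\<close>

lemma class_count_F_graph_no_edges:
  assumes a: "support a \<subseteq> {1..2 * m}" and "last_odd m a = 0"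
  shows "class_count (edges (F_graph m)) a = (\<Prod>v\<in>{1..2 * m}. a v + 1)"
proof (rule class_count_no_edges)
  define \<alpha> where "\<alpha> = first_even m a"
  have \<alpha>: "\<And>i. i \<in> {1..m} \<Longrightarrow> i < \<alpha> \<Longrightarrow> a (2 * i) = 0"
    and odd: "\<And>j. j \<in> {1..m} \<Longrightarrow> \<alpha> \<le> j \<Longrightarrow> a (2 * j - 1) = 0"
    using first_even_eq_iff[of \<alpha> m a] last_odd_eq_0_iff[of m a \<alpha>] assms first_even_range[of m a]
    by (auto simp: \<alpha>_def)
  have "a (2 * i) = 0 \<or> a (2 * j - 1) = 0" if "1 \<le> i" "i \<le> j" "j \<le> m" for i j
    using \<alpha>[of i] odd[of j] that by (cases "i < \<alpha>") auto
  then show "edge_rel (edges (F_graph m)) (support a) = {}"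
    by (fastforce simp: edge_rel_def edges_F_graph_iff support_def)
qed (use a in auto)

text \<open>The adjacent vertices \<open>2 * \<alpha>\<close> and \<open>2 * \<beta> - 1\<close> are
  joined to all odd, respectively all even, support vertices of the interval, and every induced edge
  has \<alpha> \<le> i \<le> j \<le> \<beta>.\<close>

lemma class_count_F_graph_edge:
  assumes a: "support a \<subseteq> {1..2 * m}"
    and \<alpha>: "first_even m a = \<alpha>" and \<beta>: "last_odd m a = \<beta>" "\<alpha> \<le> \<beta>" "\<beta> \<le> m"
  shows "class_count (edges (F_graph m)) a =
    (sum a {2 * \<alpha> - 1..2 * \<beta>} + 1) * (\<Prod>v\<in>{1..2 * m} - {2 * \<alpha> - 1..2 * \<beta>}. a v + 1)"
proof (rule class_count_one_component)
  let ?R = "edge_rel (edges (F_graph m)) (support a)"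
  have \<alpha>1: "1 \<le> \<alpha>" using first_even_range[of m a] \<alpha> by auto
  have low: "\<And>i. i \<in> {1..m} \<Longrightarrow> i < \<alpha> \<Longrightarrow> a (2 * i) = 0" and a\<alpha>: "a (2 * \<alpha>) \<noteq> 0"
    using first_even_eq_iff[of \<alpha> m a] \<alpha> \<beta> first_even_range[of m a] by auto
  have high: "\<And>j. j \<in> {1..m} \<Longrightarrow> \<beta> < j \<Longrightarrow> a (2 * j - 1) = 0" and a\<beta>: "a (2 * \<beta> - 1) \<noteq> 0"
    using last_odd_eq_iff[OF \<alpha> \<beta>(2,3)] \<beta>(1) by auto
  have R: "(2 * i, 2 * j - 1) \<in> ?R" "(2 * j - 1, 2 * i) \<in> ?R"
    if "1 \<le> i" "i \<le> j" "j \<le> m" "a (2 * i) \<noteq> 0" "a (2 * j - 1) \<noteq> 0" for i j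
    using that unfolding edge_rel_def support_def edges_F_graph_iff by blast+
  show "2 * \<alpha> \<in> {2 * \<alpha> - 1..2 * \<beta>}" "2 * \<alpha> \<in> support a"
    using \<beta> a\<alpha> by (auto simp: support_def)
  show "(2 * \<alpha>, v) \<in> ?R\<^sup>*" if v: "v \<in> {2 * \<alpha> - 1..2 * \<beta>} \<inter> support a" for v
  proof (cases "even v")
    case True
    then obtain i where i: "v = 2 * i" by auto
    \<comment> \<open>Even vertices are not adjacent to each other; the path runs through
      \<open>2 * \<beta> - 1\<close>.\<close>
    have "(2 * \<alpha>, 2 * \<beta> - 1) \<in> ?R"
      using \<alpha>1 \<beta> a\<alpha> a\<beta> by (intro R)
    moreover have "(2 * \<beta> - 1, 2 * i) \<in> ?R"
      using \<alpha>1 \<beta> a\<beta> v i by (intro R) (auto simp: support_def)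
    ultimately show ?thesis unfolding i by (meson rtrancl.simps)
  next
    case False
    then obtain i where i: "v = 2 * i + 1" by (auto elim: oddE)
    have "(2 * \<alpha>, 2 * (i + 1) - 1) \<in> ?R"
      using \<alpha>1 \<beta> a\<alpha> v i by (intro R) (auto simp: support_def)
    then show ?thesis by (simp add: i)
  qed
  show "?R \<subseteq> {2 * \<alpha> - 1..2 * \<beta>} \<times> {2 * \<alpha> - 1..2 * \<beta>}"
  proof -
    have "\<alpha> \<le> i \<and> j \<le> \<beta>"
      if "1 \<le> i" "i \<le> j" "j \<le> m" "a (2 * i) \<noteq> 0" "a (2 * j - 1) \<noteq> 0" for i j
      using low[of i] high[of j] that by (auto simp: not_less[symmetric])
    then show ?thesis
      unfolding edge_rel_def support_def edges_F_graph_iff by fastforce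
  qed
qed (use a \<beta> first_even_range[of m a] \<alpha> in auto)

section \<open>The Hilbert series\<close>

lemma Icc_double_eq: "{1..2 * m} = (\<lambda>i. 2 * i) ` {1..m} \<union> (\<lambda>i. 2 * i - 1) ` {1..m::nat}"
proof (intro equalityI subsetI)
  fix v assume v: "v \<in> {1..2 * m}"
  show "v \<in> (\<lambda>i. 2 * i) ` {1..m} \<union> (\<lambda>i. 2 * i - 1) ` {1..m}"
  proof (cases "even v")
    case True
    then show ?thesis using v by (auto elim!: evenE)
  next
    case False
    then obtain i where "v = 2 * i + 1" by (auto elim: oddE)
    then have "v = 2 * (i + 1) - 1" "i + 1 \<in> {1..m}" using v by auto
    then show ?thesis by blast
  qed
qed auto

lemma ball_Icc_double:
  "(\<forall>v\<in>{1..2 * m}. P v) \<longleftrightarrow> (\<forall>i\<in>{1..m::nat}. P (2 * i) \<and> P (2 * i - 1))"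
  unfolding Icc_double_eq by auto

lemma prod_Icc_double: "(\<Prod>v\<in>{1..2 * m}. f v) = (\<Prod>i\<in>{1..m::nat}. f (2 * i) * f (2 * i - 1))"
  by (induction m) (auto simp: mult_ac)

text \<open>Absorbs the condition defining a stratum into the vertex factors.\<close>

lemma prod_of_bool:
  "finite V \<Longrightarrow> (\<Prod>v\<in>V. of_bool (P v) * f v) = of_bool (\<forall>v\<in>V. P v) * (\<Prod>v\<in>V. f v :: 'a::comm_semiring_1)"
  by (induction V rule: finite_induct) auto

section \<open>The series of a single stratum\<close>

definition stratum_fps :: "nat \<Rightarrow> nat \<Rightarrow> nat \<Rightarrow> rat fps" where
  "stratum_fps m \<alpha> \<beta> = Abs_fps (\<lambda>d.
     \<Sum>a | a \<in> funs_sum {1..2 * m} d \<and> first_even m a = \<alpha> \<and> last_odd m a = \<beta>.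
       of_nat (class_count (edges (F_graph m)) a))"

text \<open>The pairs of \<open>first_even\<close> and \<open>last_odd\<close> partition the
  multidegrees. The edgeless case \<beta> = 0 is separate because \<alpha> \<ge> 1, and for \<alpha>
  = m + 1 the inner sum is empty.\<close>

lemma sum_stratum_fps:
  "Abs_fps (\<lambda>d. \<Sum>a\<in>funs_sum {1..2 * m} d. of_nat (class_count (edges (F_graph m)) a)) =
    (\<Sum>\<alpha>=1..m + 1. stratum_fps m \<alpha> 0 + (\<Sum>\<beta>=\<alpha>..m. stratum_fps m \<alpha> \<beta>))"
proof (rule fps_ext)
  fix d
  let ?c = "\<lambda>a. of_nat (class_count (edges (F_graph m)) a) :: rat"
  let ?A = "funs_sum {1..2 * m} d"
  let ?T = "SIGMA \<alpha>:{1..m + 1}. insert 0 {\<alpha>..m}"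
  have "(\<Sum>a\<in>?A. ?c a) = (\<Sum>t\<in>?T. \<Sum>a | a \<in> ?A \<and> (first_even m a, last_odd m a) = t. ?c a)"
  proof (rule sum.group[symmetric])
    have "(first_even m a, last_odd m a) \<in> ?T" for a
      using first_even_range[of m a] last_odd_range[of m a] by simp
    then show "(\<lambda>a. (first_even m a, last_odd m a)) ` ?A \<subseteq> ?T" by blast
  qed (auto simp: finite_funs_sum)
  also have "\<dots> = (\<Sum>(\<alpha>, \<beta>)\<in>?T. fps_nth (stratum_fps m \<alpha> \<beta>) d)"
    by (rule sum.cong) (auto simp: stratum_fps_def)
  also have "\<dots> = (\<Sum>\<alpha>=1..m + 1. \<Sum>\<beta>\<in>insert 0 {\<alpha>..m}. fps_nth (stratum_fps m \<alpha> \<beta>) d)"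
    by (subst sum.Sigma) auto
  also have "\<dots> = (\<Sum>\<alpha>=1..m + 1. fps_nth (stratum_fps m \<alpha> 0) d + (\<Sum>\<beta>=\<alpha>..m. fps_nth (stratum_fps m \<alpha> \<beta>) d))"
    by (intro sum.cong refl sum.insert) auto
  finally show "fps_nth (Abs_fps (\<lambda>d. \<Sum>a\<in>funs_sum {1..2 * m} d. ?c a)) d =
      fps_nth (\<Sum>\<alpha>=1..m + 1. stratum_fps m \<alpha> 0 + (\<Sum>\<beta>=\<alpha>..m. stratum_fps m \<alpha> \<beta>)) d"
    by (simp add: fps_sum_nth)
qed

text \<open>For each index other than \<alpha>, one of the vertices \<open>2 * i\<close>,
  \<open>2 * i - 1\<close> is absent and the other is free. At \<alpha> the odd one is absent and
  the even one present; for \<alpha> = m + 1 there is no exceptional index.\<close>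

lemma stratum_fps_no_edges:
  assumes \<alpha>: "\<alpha> \<in> {1..m + 1}"
  shows "stratum_fps m \<alpha> 0 = (\<Prod>i=1..m. if i = \<alpha> then geo ^ 2 - 1 else geo ^ 2)"
proof -
  \<comment> \<open>The stratum as a condition on each vertex separately: an odd v \<ge>
    \<open>2 * \<alpha> - 1\<close> has index at least \<alpha>.\<close>
  define ok where "ok v n \<longleftrightarrow> (if even v then (v < 2 * \<alpha> \<longrightarrow> n = 0) \<and> (v = 2 * \<alpha> \<longrightarrow> n \<noteq> 0)
    else 2 * \<alpha> - 1 \<le> v \<longrightarrow> n = 0)" for v n :: nat
  have ok_even: "ok (2 * i) n \<longleftrightarrow> (i < \<alpha> \<longrightarrow> n = 0) \<and> (i = \<alpha> \<longrightarrow> n \<noteq> 0)" for i n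
    by (simp add: ok_def)
  have ok_odd: "ok (2 * i - Suc 0) n \<longleftrightarrow> (\<alpha> \<le> i \<longrightarrow> n = 0)" if "i \<in> {1..m}" for i n
    using that \<alpha> by (auto simp: ok_def)
  have ok_iff: "first_even m a = \<alpha> \<and> last_odd m a = 0 \<longleftrightarrow> (\<forall>v\<in>{1..2 * m}. ok v (a v))" for a
  proof -
    have "first_even m a = \<alpha> \<and> last_odd m a = 0 \<longleftrightarrow>
        (\<forall>i\<in>{1..m}. i < \<alpha> \<longrightarrow> a (2 * i) = 0) \<and> (\<alpha> \<le> m \<longrightarrow> a (2 * \<alpha>) \<noteq> 0) \<and>
        (\<forall>j\<in>{1..m}. \<alpha> \<le> j \<longrightarrow> a (2 * j - 1) = 0)"
      using first_even_eq_iff[OF \<alpha>, of a] last_odd_eq_0_iff[of m a \<alpha>] by blast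
    also have "\<dots> \<longleftrightarrow> (\<forall>i\<in>{1..m}. ok (2 * i) (a (2 * i)) \<and> ok (2 * i - 1) (a (2 * i - 1)))"
      using \<alpha> by (auto simp: ok_even ok_odd)
    finally show ?thesis by (simp only: ball_Icc_double)
  qed
  have "(\<Sum>a | a \<in> funs_sum {1..2 * m} d \<and> first_even m a = \<alpha> \<and> last_odd m a = 0.
        of_nat (class_count (edges (F_graph m)) a)) =
      (\<Sum>a\<in>funs_sum {1..2 * m} d. \<Prod>v\<in>{1..2 * m}. of_bool (ok v (a v)) * (of_nat (a v) + 1 :: rat))" for d
  proof (rule sum.mono_neutral_cong_left)
    fix a assume "a \<in> {a. a \<in> funs_sum {1..2 * m} d \<and> first_even m a = \<alpha> \<and> last_odd m a = 0}"
    then show "of_nat (class_count (edges (F_graph m)) a) =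
        (\<Prod>v\<in>{1..2 * m}. of_bool (ok v (a v)) * (of_nat (a v) + 1 :: rat))"
      using ok_iff[of a]
      by (subst class_count_F_graph_no_edges) (auto simp: funs_sum_def prod_of_bool add.commute)
  next
    show "\<forall>a\<in>funs_sum {1..2 * m} d - {a. a \<in> funs_sum {1..2 * m} d \<and> first_even m a = \<alpha> \<and> last_odd m a = 0}.
        (\<Prod>v\<in>{1..2 * m}. of_bool (ok v (a v)) * (of_nat (a v) + 1 :: rat)) = 0"
      by (auto simp: prod_of_bool ok_iff)
  qed (auto simp: finite_funs_sum)
  then have "stratum_fps m \<alpha> 0 = (\<Prod>v\<in>{1..2 * m}. Abs_fps (\<lambda>n. of_bool (ok v n) * (of_nat n + 1)))"
    unfolding stratum_fps_def
    using funs_sum_fps_prod[of "{1..2 * m}" "\<lambda>v n. of_bool (ok v n) * (of_nat n + 1 :: rat)"] by simp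
  also have "\<dots> = (\<Prod>i=1..m. if i = \<alpha> then geo ^ 2 - 1 else geo ^ 2)"
    unfolding prod_Icc_double
  proof (rule prod.cong)
    fix i assume i: "i \<in> {1..m}"
    consider "i < \<alpha>" | "i = \<alpha>" | "\<alpha> < i" by linarith
    then show "Abs_fps (\<lambda>n. of_bool (ok (2 * i) n) * (of_nat n + 1)) *
        Abs_fps (\<lambda>n. of_bool (ok (2 * i - 1) n) * (of_nat n + 1)) =
        (if i = \<alpha> then geo ^ 2 - 1 else geo ^ 2)"
      unfolding ok_even ok_odd[OF i, folded One_nat_def]
      by cases (simp_all add: fps_zero_eq geo_square fps_pos_square_eq)
  qed simp
  finally show ?thesis .
qed

text \<open>The class factor of the interval is its degree plus 1, which is produced by multiplying
  with \<open>fps_X\<close> and differentiating. Two of the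
  \<open>2 * (\<beta> - \<alpha>) + 2\<close> vertices are forced into the support, whence the cube.
  Each index outside has one absent and one free vertex.\<close>

lemma stratum_fps_edge:
  assumes \<alpha>: "1 \<le> \<alpha>" "\<alpha> \<le> \<beta>" "\<beta> \<le> m"
  shows "stratum_fps m \<alpha> \<beta> = fps_deriv (fps_X ^ 3 * geo ^ (2 * (\<beta> - \<alpha>) + 2)) * geo ^ (2 * (m - 1 - (\<beta> - \<alpha>)))"
proof -
  define C where "C = {2 * \<alpha> - 1..2 * \<beta>}"
  define V where "V = {1..2 * m}"
  have CV: "C \<subseteq> V" "C \<union> (V - C) = V" and fin: "finite C" "finite (V - C)"
    using \<alpha> by (auto simp: C_def V_def)
  define ok where "ok v n \<longleftrightarrow> (if even v then (v < 2 * \<alpha> \<longrightarrow> n = 0) \<and> (v = 2 * \<alpha> \<longrightarrow> n \<noteq> 0)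
    else (2 * \<beta> - 1 < v \<longrightarrow> n = 0) \<and> (v = 2 * \<beta> - 1 \<longrightarrow> n \<noteq> 0))" for v n :: nat
  have ok_even: "ok (2 * i) n \<longleftrightarrow> (i < \<alpha> \<longrightarrow> n = 0) \<and> (i = \<alpha> \<longrightarrow> n \<noteq> 0)" for i n
    by (simp add: ok_def)
  have ok_odd: "ok (2 * i - Suc 0) n \<longleftrightarrow> (\<beta> < i \<longrightarrow> n = 0) \<and> (i = \<beta> \<longrightarrow> n \<noteq> 0)" if "i \<in> {1..m}" for i n
    using that \<alpha> by (auto simp: ok_def)
  have ok_iff: "first_even m a = \<alpha> \<and> last_odd m a = \<beta> \<longleftrightarrow> (\<forall>v\<in>V. ok v (a v))" for a
  proof -
    have "first_even m a = \<alpha> \<and> last_odd m a = \<beta> \<longleftrightarrow>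
        (\<forall>i\<in>{1..m}. i < \<alpha> \<longrightarrow> a (2 * i) = 0) \<and> a (2 * \<alpha>) \<noteq> 0 \<and>
        a (2 * \<beta> - 1) \<noteq> 0 \<and> (\<forall>j\<in>{1..m}. \<beta> < j \<longrightarrow> a (2 * j - 1) = 0)"
      using first_even_eq_iff[of \<alpha> m a] last_odd_eq_iff[of m a \<alpha> \<beta>] \<alpha> by auto
    also have "\<dots> \<longleftrightarrow> (\<forall>i\<in>{1..m}. ok (2 * i) (a (2 * i)) \<and> ok (2 * i - 1) (a (2 * i - 1)))"
      using \<alpha> by (auto simp: ok_even ok_odd)
    finally show ?thesis by (simp only: ball_Icc_double V_def)
  qed
  \<comment> \<open>The weight is split into a factor on the interval and a factor on its
    complement; the former does not factor over vertices because of the sum.\<close>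
  define F :: "(nat \<Rightarrow> nat) \<Rightarrow> rat"
    where "F a = (of_nat (sum a C) + 1) * (\<Prod>v\<in>C. of_bool (ok v (a v)))" for a
  define H :: "(nat \<Rightarrow> nat) \<Rightarrow> rat"
    where "H a = (\<Prod>v\<in>V - C. of_bool (ok v (a v)) * (of_nat (a v) + 1))" for a
  have prodC: "(\<Prod>v\<in>C. of_bool (ok v (a v))) = (of_bool (\<forall>v\<in>C. ok v (a v)) :: rat)" for a
    using prod_of_bool[OF fin(1), of "\<lambda>v. ok v (a v)" "\<lambda>_. 1 :: rat"] by simp
  have FH: "F a * H a = (of_bool (\<forall>v\<in>V. ok v (a v))) * ((of_nat (sum a C) + 1) * (\<Prod>v\<in>V - C. of_nat (a v) + 1))" for a
  proof -
    have "(\<forall>v\<in>V. ok v (a v)) \<longleftrightarrow> (\<forall>v\<in>C. ok v (a v)) \<and> (\<forall>v\<in>V - C. ok v (a v))"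
      using CV by blast
    then show ?thesis
      unfolding F_def H_def prodC prod_of_bool[OF fin(2)] by (simp add: of_bool_conj)
  qed
  have "(\<Sum>a | a \<in> funs_sum V d \<and> first_even m a = \<alpha> \<and> last_odd m a = \<beta>.
        of_nat (class_count (edges (F_graph m)) a)) = (\<Sum>a\<in>funs_sum V d. F a * H a)" for d
  proof (rule sum.mono_neutral_cong_left)
    fix a assume a: "a \<in> {a. a \<in> funs_sum V d \<and> first_even m a = \<alpha> \<and> last_odd m a = \<beta>}"
    then have "class_count (edges (F_graph m)) a = (sum a C + 1) * (\<Prod>v\<in>V - C. a v + 1)"
      unfolding C_def V_def using \<alpha> by (intro class_count_F_graph_edge) (auto simp: funs_sum_def)
    moreover have "\<forall>v\<in>V. ok v (a v)" using a ok_iff by blast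
    ultimately show "of_nat (class_count (edges (F_graph m)) a) = F a * H a"
      by (simp add: FH distrib_right add.commute)
  next
    show "\<forall>a\<in>funs_sum V d - {a. a \<in> funs_sum V d \<and> first_even m a = \<alpha> \<and> last_odd m a = \<beta>}. F a * H a = 0"
      by (auto simp: FH ok_iff)
  qed (auto simp: finite_funs_sum V_def)
  then have "stratum_fps m \<alpha> \<beta> = Abs_fps (\<lambda>d. \<Sum>a\<in>funs_sum (C \<union> (V - C)) d. F a * H a)"
    unfolding stratum_fps_def CV(2) by (simp add: V_def)
  also have "\<dots> = Abs_fps (\<lambda>d. \<Sum>a\<in>funs_sum C d. F a) * Abs_fps (\<lambda>d. \<Sum>a\<in>funs_sum (V - C) d. H a)"
    using fin by (intro funs_sum_fps_mult) (auto simp: F_def H_def intro!: prod.cong arg_cong2[where f = "(*)"] sum.cong)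
  also have "Abs_fps (\<lambda>d. \<Sum>a\<in>funs_sum (V - C) d. H a) = geo ^ (2 * (m - 1 - (\<beta> - \<alpha>)))"
  proof -
    have "Abs_fps (\<lambda>d. \<Sum>a\<in>funs_sum (V - C) d. H a) =
        (\<Prod>v\<in>V - C. Abs_fps (\<lambda>n. of_bool (ok v n) * (of_nat n + 1)))"
      unfolding H_def by (rule funs_sum_fps_prod[OF fin(2)])
    also have "\<dots> = (\<Prod>v\<in>V. if v \<in> C then 1 else Abs_fps (\<lambda>n. of_bool (ok v n) * (of_nat n + 1)))"
      by (rule prod.mono_neutral_cong_left) (auto simp: V_def)
    also have "\<dots> = (\<Prod>i=1..m. if i \<in> {\<alpha>..\<beta>} then 1 else geo ^ 2)"
      unfolding V_def prod_Icc_double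
    proof (rule prod.cong)
      fix i assume i: "i \<in> {1..m}"
      have C: "2 * i \<in> C \<longleftrightarrow> i \<in> {\<alpha>..\<beta>}" "2 * i - 1 \<in> C \<longleftrightarrow> i \<in> {\<alpha>..\<beta>}"
        using i \<alpha> by (auto simp: C_def)
      consider "i < \<alpha>" "i < \<beta>" | "\<alpha> \<le> i" "i \<le> \<beta>" | "\<alpha> < i" "\<beta> < i" using \<alpha> by linarith
      then show "(if 2 * i \<in> C then 1 else Abs_fps (\<lambda>n. of_bool (ok (2 * i) n) * (of_nat n + 1))) *
          (if 2 * i - 1 \<in> C then 1 else Abs_fps (\<lambda>n. of_bool (ok (2 * i - 1) n) * (of_nat n + 1))) =
          (if i \<in> {\<alpha>..\<beta>} then 1 else geo ^ 2)"
        unfolding C ok_even ok_odd[OF i, folded One_nat_def]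
        by cases (simp_all add: fps_zero_eq geo_square)
    qed simp
    also have "\<dots> = (\<Prod>i\<in>{1..m} - {\<alpha>..\<beta>}. geo ^ 2)"
      by (rule prod.mono_neutral_cong_right) auto
    also have "\<dots> = (geo ^ 2) ^ card ({1..m} - {\<alpha>..\<beta>})"
      by (rule prod_constant)
    also have "card ({1..m} - {\<alpha>..\<beta>}) = m - 1 - (\<beta> - \<alpha>)"
      using \<alpha> by (subst card_Diff_subset) auto
    finally show ?thesis by (simp add: power_mult)
  qed
  also have "Abs_fps (\<lambda>d. \<Sum>a\<in>funs_sum C d. F a) = fps_deriv (fps_X ^ 3 * geo ^ (2 * (\<beta> - \<alpha>) + 2))"
  proof -
    let ?P = "\<Prod>v\<in>C. Abs_fps (\<lambda>n. of_bool (ok v n) :: rat)"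
    \<comment> \<open>In degree \<open>d\<close> the sum over \<open>C\<close> is \<open>d\<close>,
      so the class factor leaves the inner sum and vertex factors remain.\<close>
    have "Abs_fps (\<lambda>d. \<Sum>a\<in>funs_sum C d. F a) =
        Abs_fps (\<lambda>d. of_nat (d + 1) * (\<Sum>a\<in>funs_sum C d. \<Prod>v\<in>C. of_bool (ok v (a v))))"
      by (rule fps_ext) (auto simp: F_def funs_sum_def sum_distrib_left intro!: sum.cong)
    also have "\<dots> = fps_deriv (fps_X * Abs_fps (\<lambda>d. \<Sum>a\<in>funs_sum C d. \<Prod>v\<in>C. of_bool (ok v (a v))))"
      by (rule fps_ext) (simp add: distrib_right add.commute)
    also have "Abs_fps (\<lambda>d. \<Sum>a\<in>funs_sum C d. \<Prod>v\<in>C. of_bool (ok v (a v))) = ?P"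
      by (rule funs_sum_fps_prod[OF fin(1)])
    also have "?P = (\<Prod>v\<in>C. (if v \<in> {2 * \<alpha>, 2 * \<beta> - 1} then fps_X else 1) * geo)"
    proof (rule prod.cong)
      fix v assume v: "v \<in> C"
      \<comment> \<open>Inside the interval the requirements of absence are void; only presence at
        the two distinguished vertices survives.\<close>
      have ok: "ok v n \<longleftrightarrow> (v \<in> {2 * \<alpha>, 2 * \<beta> - 1} \<longrightarrow> n \<noteq> 0)" for n
      proof (cases "even v")
        case True
        moreover have "odd (2 * \<alpha> - 1)" "odd (2 * \<beta> - 1)" using \<alpha> by auto
        ultimately have "v \<noteq> 2 * \<alpha> - 1" "v \<noteq> 2 * \<beta> - 1" by metis+
        moreover from this have "2 * \<alpha> \<le> v" using v by (auto simp: C_def)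
        ultimately show ?thesis using True by (auto simp: ok_def)
      next
        case False
        then have "v \<noteq> 2 * \<alpha>" "v \<noteq> 2 * \<beta>" by auto
        moreover from this have "v \<le> 2 * \<beta> - 1" using v by (auto simp: C_def)
        ultimately show ?thesis using False by (auto simp: ok_def)
      qed
      show "Abs_fps (\<lambda>n. of_bool (ok v n) :: rat) = (if v \<in> {2 * \<alpha>, 2 * \<beta> - 1} then fps_X else 1) * geo"
        unfolding ok by (cases "v \<in> {2 * \<alpha>, 2 * \<beta> - 1}") (simp_all del: insert_iff add: fps_pos_eq)
    qed simp
    also have "\<dots> = fps_X ^ card (C \<inter> {2 * \<alpha>, 2 * \<beta> - 1}) * geo ^ card C"
      using fin by (simp add: prod.distrib prod.If_cases del: insert_iff)
    also have "C \<inter> {2 * \<alpha>, 2 * \<beta> - 1} = {2 * \<alpha>, 2 * \<beta> - 1}"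
      using \<alpha> by (auto simp: C_def)
    also have "card {2 * \<alpha>, 2 * \<beta> - 1} = 2"
    proof -
      have "2 * \<alpha> \<noteq> 2 * \<beta> - 1" using \<alpha> by presburger
      then show ?thesis by simp
    qed
    also have "card C = 2 * (\<beta> - \<alpha>) + 2"
      using \<alpha> by (simp add: C_def)
    also have "fps_X * (fps_X ^ 2 * geo ^ (2 * (\<beta> - \<alpha>) + 2)) = fps_X ^ 3 * geo ^ (2 * (\<beta> - \<alpha>) + 2)"
      by (simp add: eval_nat_numeral mult.assoc)
    finally show ?thesis .
  qed
  finally show ?thesis .
qed

section \<open>Numerators over the common denominator\<close>

lemma fps_deriv_geo_power: "fps_deriv (geo ^ n) = of_nat n * geo ^ Suc n"
  by (induction n) (simp_all add: fps_deriv_geo power2_eq_square algebra_simps)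

lemma geo_power_times: "geo ^ n * (1 - fps_X) ^ n = 1"
  by (simp add: geo_times flip: power_mult_distrib)

lemma stratum_fps_no_edges_times:
  assumes "\<alpha> \<in> {1..m}"
  shows "stratum_fps m \<alpha> 0 * (1 - fps_X) ^ (2 * m + 1) = (1 - fps_X) - (1 - fps_X) ^ 3"
proof -
  have "stratum_fps m \<alpha> 0 = (geo ^ 2 - 1) * (\<Prod>i\<in>{1..m} - {\<alpha>}. if i = \<alpha> then geo ^ 2 - 1 else geo ^ 2)"
    using assms by (subst stratum_fps_no_edges) (auto simp: prod.remove[of _ \<alpha>])
  also have "(\<Prod>i\<in>{1..m} - {\<alpha>}. if i = \<alpha> then geo ^ 2 - 1 else geo ^ 2) = (\<Prod>i\<in>{1..m} - {\<alpha>}. geo ^ 2)"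
    by (rule prod.cong) auto
  also have "\<dots> = geo ^ (2 * (m - 1))"
    using assms by (simp add: power_mult)
  finally have "stratum_fps m \<alpha> 0 = (geo ^ 2 - 1) * geo ^ (2 * (m - 1))" .
  moreover have "2 * m + 1 = 2 * (m - 1) + (2 + 1)" using assms by auto
  ultimately have "stratum_fps m \<alpha> 0 * (1 - fps_X) ^ (2 * m + 1) =
      (geo ^ 2 * (1 - fps_X) ^ 2 - (1 - fps_X) ^ 2) * (1 - fps_X) *
      (geo ^ (2 * (m - 1)) * (1 - fps_X) ^ (2 * (m - 1)))"
    by (simp only: power_add power_one_right) (simp add: algebra_simps)
  also have "\<dots> = (1 - (1 - fps_X) ^ 2) * (1 - fps_X)"
    by (simp only: geo_power_times mult_1_right)
  also have "\<dots> = (1 - fps_X) - (1 - fps_X) ^ 3"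
    by (simp add: power2_eq_square power3_eq_cube algebra_simps)
  finally show ?thesis .
qed

lemma stratum_fps_empty_times:
  "stratum_fps m (m + 1) 0 * (1 - fps_X) ^ (2 * m + 1) = 1 - fps_X"
proof -
  have "stratum_fps m (m + 1) 0 = (\<Prod>i=1..m. geo ^ 2)"
    by (subst stratum_fps_no_edges) (auto intro!: prod.cong)
  then have "stratum_fps m (m + 1) 0 = geo ^ (2 * m)" by (simp add: power_mult)
  then show ?thesis
    using geo_power_times[of "2 * m"] by (simp add: mult.assoc[symmetric] mult.commute[of "1 - fps_X"])
qed

text \<open>By the product rule the derivative has denominator exponent
  \<open>2 * (\<beta> - \<alpha>) + 3\<close>, and the outside vertices raise it to
  \<open>2 * m + 1\<close>. The numerator depends on \<beta> - \<alpha> only.\<close>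

lemma stratum_fps_edge_times:
  assumes "1 \<le> \<alpha>" "\<alpha> \<le> \<beta>" "\<beta> \<le> m"
  shows "stratum_fps m \<alpha> \<beta> * (1 - fps_X) ^ (2 * m + 1) =
    fps_X ^ 2 * (3 + (2 * of_nat (\<beta> - \<alpha>) - 1) * fps_X)"
proof -
  define k where "k = \<beta> - \<alpha>"
  \<comment> \<open>Chosen so that the interval has \<open>Suc n\<close> vertices.\<close>
  define n where "n = 2 * k + 1"
  define W :: "rat fps" where "W = 1 - fps_X"
  have gW: "geo ^ i * W ^ i = 1" for i by (simp add: geo_power_times W_def)
  have "fps_deriv (fps_X ^ 3 * geo ^ Suc n) =
      3 * fps_X ^ 2 * geo ^ Suc n + of_nat (Suc n) * fps_X ^ 3 * geo ^ Suc (Suc n)"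
  proof -
    have "fps_deriv (fps_X ^ 3 :: rat fps) = 3 * fps_X ^ 2"
      by (simp add: power2_eq_square power3_eq_cube algebra_simps)
    then show ?thesis
      by (simp only: fps_deriv_mult fps_deriv_geo_power) (simp only: mult_ac add.commute)
  qed
  then have "fps_deriv (fps_X ^ 3 * geo ^ Suc n) * W ^ Suc (Suc n) =
      3 * fps_X ^ 2 * W * (geo ^ Suc n * W ^ Suc n) +
      of_nat (Suc n) * fps_X ^ 3 * (geo ^ Suc (Suc n) * W ^ Suc (Suc n))"
    by (simp add: algebra_simps)
  also have "\<dots> = 3 * fps_X ^ 2 * W + of_nat (Suc n) * fps_X ^ 3"
    by (simp only: gW mult_1_right)
  also have "\<dots> = fps_X ^ 2 * (3 + (2 * of_nat k - 1) * fps_X)"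
    by (simp add: W_def n_def power2_eq_square power3_eq_cube algebra_simps)
  finally have deriv: "fps_deriv (fps_X ^ 3 * geo ^ Suc n) * W ^ Suc (Suc n) =
    fps_X ^ 2 * (3 + (2 * of_nat k - 1) * fps_X)" .
  have exps: "2 * m + 1 = Suc (Suc n) + 2 * (m - 1 - k)" "2 * k + 2 = Suc n"
    using assms by (auto simp: n_def k_def)
  have "stratum_fps m \<alpha> \<beta> * W ^ (2 * m + 1) =
      fps_deriv (fps_X ^ 3 * geo ^ Suc n) * W ^ Suc (Suc n) *
      (geo ^ (2 * (m - 1 - k)) * W ^ (2 * (m - 1 - k)))"
    unfolding stratum_fps_edge[OF assms] k_def[symmetric] exps power_add by (simp only: mult_ac)
  then show ?thesis unfolding gW deriv by (simp add: W_def k_def)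
qed

section \<open>Closed forms of the numerical sums and assembly of the series\<close>

text \<open>The new column \<beta> = m + 1 contributes each difference from 0 to m exactly
  once.\<close>

lemma double_sum_Suc:
  fixes f :: "nat \<Rightarrow> nat"
  shows "(\<Sum>\<alpha>=1..Suc m. \<Sum>\<beta>=\<alpha>..Suc m. f (\<beta> - \<alpha>)) =
    (\<Sum>\<alpha>=1..m. \<Sum>\<beta>=\<alpha>..m. f (\<beta> - \<alpha>)) + (\<Sum>k\<le>m. f k)"
proof -
  have "(\<Sum>\<alpha>=1..Suc m. \<Sum>\<beta>=\<alpha>..Suc m. f (\<beta> - \<alpha>)) =
      (\<Sum>\<alpha>=1..Suc m. (\<Sum>\<beta>=\<alpha>..m. f (\<beta> - \<alpha>)) + f (Suc m - \<alpha>))"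
    by (intro sum.cong) auto
  also have "\<dots> = (\<Sum>\<alpha>=1..m. \<Sum>\<beta>=\<alpha>..m. f (\<beta> - \<alpha>)) + (\<Sum>\<alpha>=1..Suc m. f (Suc m - \<alpha>))"
    by (simp add: sum.distrib)
  also have "(\<Sum>\<alpha>=1..Suc m. f (Suc m - \<alpha>)) = (\<Sum>k\<le>m. f k)"
    by (rule sum.reindex_bij_witness[of _ "\<lambda>k. Suc m - k" "\<lambda>\<alpha>. Suc m - \<alpha>"]) auto
  finally show ?thesis .
qed

lemma double_sum_one:
  fixes m :: nat
  shows "2 * (\<Sum>\<alpha>=1..m. \<Sum>\<beta>=\<alpha>..m. 1) = m * (m + 1)"
  by (induction m) (simp, subst double_sum_Suc[where f = "\<lambda>_. 1"], simp add: algebra_simps)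

text \<open>The sum is the binomial coefficient of m + 1 over 3; the form with \<open>+ m\<close>
  avoids subtraction of naturals.\<close>

lemma double_sum_diff:
  fixes m :: nat
  shows "6 * (\<Sum>\<alpha>=1..m. \<Sum>\<beta>=\<alpha>..m. \<beta> - \<alpha>) + m = m ^ 3"
proof (induction m)
  case (Suc m)
  have "2 * (\<Sum>k\<le>m. k) = m * (m + 1)" by (induction m) auto
  then show ?case
    using Suc unfolding double_sum_Suc[where f = "\<lambda>k. k"]
    by (simp add: power3_eq_cube algebra_simps)
qed simp

lemma sum_squares_pred: "6 * (\<Sum>k = 1..m - 1. (of_nat k)^2) = (of_nat m * (of_nat m - 1) * (2 * of_nat m - 1) :: rat)"
proof (induction m)
  case (Suc m)
  then show ?case
    by (cases m) (auto simp: power2_eq_square algebra_simps)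
qed simp

theorem proposition3p8:
  fixes m :: nat
    and G :: "nat graph"
    and J :: "(nat, 'k::field) mpoly set"
    and h0 h1 h2 h3 :: rat
  assumes "m \<ge> 2"
    and "G = F_graph m"
    and "J = binomial_edge_ideal G"
    and "h0 = 1"
    and "h1 = 2 * of_nat m - 1"
    and "h2 = (3 * (of_nat m)^2 - 3 * of_nat m) / 2"
    and "h3 = (\<Sum>k = 1..m - 1. (of_nat k)^2)"
  shows "quotient_hilbert_series (verts G) J =
    (fps_const h0 + fps_const h1 * fps_X + fps_const h2 * fps_X^2 + fps_const h3 * fps_X^3)
      / (1 - fps_X)^(2 * m + 1)"
proof -
  define W :: "rat fps" where "W = 1 - fps_X"
  define M :: "rat fps" where "M = of_nat m"
  \<comment> \<open>\<open>N\<close> counts the strata with edges, and \<open>K\<close> adds up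
    their values of \<beta> - \<alpha>.\<close>
  define N K where "N = (\<Sum>\<alpha>=1..m. \<Sum>\<beta>=\<alpha>..m. 1::nat)" and "K = (\<Sum>\<alpha>=1..m. \<Sum>\<beta>=\<alpha>..m. \<beta> - \<alpha>)"
  have NK: "2 * of_nat N = (of_nat m * (of_nat m + 1) :: rat)"
    "6 * of_nat K + of_nat m = (of_nat m ^ 3 :: rat)"
    using arg_cong[OF double_sum_one[of m], of "of_nat :: nat \<Rightarrow> rat"]
      arg_cong[OF double_sum_diff[of m], of "of_nat :: nat \<Rightarrow> rat"]
    unfolding N_def[symmetric] K_def[symmetric] by (simp_all add: distrib_left)
  \<comment> \<open>These forms are the coefficients of the numerator found below, where W - W^3 =
    2X - 3X^2 + X^3 for W = 1 - X.\<close>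
  have h2: "h2 = 3 * of_nat N - 3 * of_nat m"
    using NK(1) assms by (simp add: field_simps power2_eq_square)
  have h3: "h3 = of_nat m + 2 * of_nat K - of_nat N"
    using NK sum_squares_pred[of m] unfolding assms(7)[symmetric]
    by (simp add: power3_eq_cube algebra_simps)
  have const: "fps_const h0 = 1" "fps_const h1 = 2 * M - 1"
    "fps_const h2 = 3 * of_nat N - 3 * M" "fps_const h3 = M + 2 * of_nat K - of_nat N"
    unfolding h2 h3 assms(4,5) M_def
    by (simp_all flip: fps_const_add fps_const_sub fps_const_mult add: fps_of_nat fps_numeral_fps_const)
  have "quotient_hilbert_series (verts G) J =
      (\<Sum>\<alpha>=1..m + 1. stratum_fps m \<alpha> 0 + (\<Sum>\<beta>=\<alpha>..m. stratum_fps m \<alpha> \<beta>))"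
    unfolding assms(2,3) sum_stratum_fps[symmetric]
    using quotient_hilbert_series_binomial_edge_ideal[of "F_graph m"] edges_F_graph_subset[of m]
    by (simp add: verts_F_graph)
  also have "\<dots> = (\<Sum>\<alpha>=1..m. stratum_fps m \<alpha> 0) + stratum_fps m (m + 1) 0 +
      (\<Sum>\<alpha>=1..m. \<Sum>\<beta>=\<alpha>..m. stratum_fps m \<alpha> \<beta>)"
    by (simp add: sum.distrib)
  finally have "quotient_hilbert_series (verts G) J * W ^ (2 * m + 1) =
      (\<Sum>\<alpha>=1..m. stratum_fps m \<alpha> 0 * W ^ (2 * m + 1)) + stratum_fps m (m + 1) 0 * W ^ (2 * m + 1) +
      (\<Sum>\<alpha>=1..m. \<Sum>\<beta>=\<alpha>..m. stratum_fps m \<alpha> \<beta> * W ^ (2 * m + 1))"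
    by (simp only: distrib_right sum_distrib_right)
  also have "(\<Sum>\<alpha>=1..m. stratum_fps m \<alpha> 0 * W ^ (2 * m + 1)) = (\<Sum>\<alpha>=1..m. W - W ^ 3)"
    unfolding W_def by (intro sum.cong stratum_fps_no_edges_times refl)
  also have "\<dots> = M * (W - W ^ 3)" by (simp add: M_def)
  also have "stratum_fps m (m + 1) 0 * W ^ (2 * m + 1) = W"
    unfolding W_def by (rule stratum_fps_empty_times)
  also have "(\<Sum>\<alpha>=1..m. \<Sum>\<beta>=\<alpha>..m. stratum_fps m \<alpha> \<beta> * W ^ (2 * m + 1)) =
      (\<Sum>\<alpha>=1..m. \<Sum>\<beta>=\<alpha>..m. fps_X ^ 2 * (3 + (2 * of_nat (\<beta> - \<alpha>) - 1) * fps_X))"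
    unfolding W_def by (intro sum.cong refl stratum_fps_edge_times) auto
  \<comment> \<open>Separates the part constant over the strata from the part linear in \<beta> -
    \<alpha>; the factor \<open>of_nat 1\<close> makes the first sum match \<open>N\<close>.\<close>
  also have "\<dots> = (\<Sum>\<alpha>=1..m. \<Sum>\<beta>=\<alpha>..m. (3 * fps_X ^ 2 - fps_X ^ 3) * of_nat 1 + 2 * fps_X ^ 3 * of_nat (\<beta> - \<alpha>))"
    by (intro sum.cong refl) (simp add: power2_eq_square power3_eq_cube algebra_simps)
  also have "\<dots> = (3 * fps_X ^ 2 - fps_X ^ 3) * of_nat N + 2 * fps_X ^ 3 * of_nat K"
    unfolding N_def K_def sum.distrib of_nat_sum sum_distrib_left ..
  also have "M * (W - W ^ 3) + W + ((3 * fps_X ^ 2 - fps_X ^ 3) * of_nat N + 2 * fps_X ^ 3 * of_nat K) =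
      fps_const h0 + fps_const h1 * fps_X + fps_const h2 * fps_X^2 + fps_const h3 * fps_X^3"
    unfolding const W_def by (simp add: power2_eq_square power3_eq_cube algebra_simps)
  finally have "quotient_hilbert_series (verts G) J * W ^ (2 * m + 1) =
    fps_const h0 + fps_const h1 * fps_X + fps_const h2 * fps_X^2 + fps_const h3 * fps_X^3" .
  moreover have "W ^ (2 * m + 1) \<noteq> 0"
  proof -
    have "fps_nth W 0 \<noteq> 0" by (simp add: W_def)
    then have "W \<noteq> 0" by auto
    then show ?thesis by simp
  qed
  ultimately show ?thesis
    unfolding W_def by (metis nonzero_mult_div_cancel_right)
qed

end
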